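(* Let $\mu$ be a probability distribution on $\mathbb{R}$ with zero mean and finite nonzero variance, and suppose $D\subset\mathbb{C}$ solves the conformal Skorokhod embedding problem for $\mu$. If $[\alpha,\beta]$ (with $-\infty\le\alpha\le\beta\le\infty$) is the smallest interval containing the support of $\mu$, then \[ \lambda(D)\geq \frac{\pi^2}{2(\beta-\alpha)^2}, \] where the right-hand side is understood to be $0$ if $\beta-\alpha=\infty$.
   Context: Let $W=(W_t:t\ge0)$ be a standard complex Brownian motion (generator $\frac12\Delta$ on $\mathbb{C}\cong\mathbb{R}^2$), started at $0$ under $\mathbb{P}_0$. For an open set $D\subset\mathbb{C}$ containing $0$, $\tau_D=\inf\{t\ge0:W_t\notin D\}$. Conformal Skorokhod embedding problem (CSEP): a simply connected domain $D\subset\mathbb{C}$ containing $0$ is said to solve the CSEP for $\mu$ if, under $\mathbb{P}_0$, $\operatorname{Re}W_{\tau_D}\sim\mu$ and $\mathbb{E}_0[\tau_D]<\infty$. Rate: $\lambda(D)=-\lim_{t\to\infty}\frac1t\log\mathbb{P}_0(\tau_D>t)$ (the limit exists, is nonnegative and finite; $2\lambda(D)$ is the bottom of the spectrum of the Dirichlet Laplacian $-\Delta$ on $D$). *)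

theory Defs
  imports "HOL-Probability.Probability"
begin

text \<open>
  Standard complex Brownian motion started at 0. The density of the increments is the
  transition density of the heat semigroup generated by half the Laplacian on the plane,
  so real and imaginary parts are independent standard real Brownian motions.
  Only the times \<open>t \<ge> 0\<close> are meaningful.
\<close>

locale complex_brownian_motion = prob_space M
  for M :: "'a measure" and W :: "real \<Rightarrow> 'a \<Rightarrow> complex" +
  assumes measurable_W: "\<And>t. 0 \<le> t \<Longrightarrow> W t \<in> borel_measurable M"
    and start_at_0: "AE \<omega> in M. W 0 \<omega> = 0"
    and continuous_paths: "\<And>\<omega>. \<omega> \<in> space M \<Longrightarrow> continuous_on {0..} (\<lambda>t. W t \<omega>)"
    and indep_increments: "\<And>(n::nat) (t :: nat \<Rightarrow> real). 0 \<le> t 0 \<Longrightarrow> mono t \<Longrightarrow>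
          indep_vars (\<lambda>_. borel) (\<lambda>i \<omega>. W (t (Suc i)) \<omega> - W (t i) \<omega>) {..<n}"
    and gaussian_increments: "\<And>s t. 0 \<le> s \<Longrightarrow> s < t \<Longrightarrow>
          distributed M lborel (\<lambda>\<omega>. W t \<omega> - W s \<omega>)
            (\<lambda>z. ennreal (exp (- (cmod z)\<^sup>2 / (2 * (t - s))) / (2 * pi * (t - s))))"

text \<open>The infimum is taken in \<^typ>\<open>ennreal\<close>, so it is \<open>\<infinity>\<close> on paths that never leave \<open>D\<close>.\<close>

definition exit_time :: "(real \<Rightarrow> 'a \<Rightarrow> complex) \<Rightarrow> complex set \<Rightarrow> 'a \<Rightarrow> ennreal" where
  "exit_time W D \<omega> = (INF t\<in>{t. 0 \<le> t \<and> W t \<omega> \<notin> D}. ennreal t)"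

text \<open>
  Where the exit time is infinite, \<^const>\<open>enn2real\<close> gives the junk value 0; by the condition
  on the expectation this concerns a null set only.
\<close>

definition solves_CSEP ::
    "'a measure \<Rightarrow> (real \<Rightarrow> 'a \<Rightarrow> complex) \<Rightarrow> complex set \<Rightarrow> real measure \<Rightarrow> bool" where
  "solves_CSEP M W D \<mu> \<longleftrightarrow>
     open D \<and> connected D \<and> simply_connected D \<and> 0 \<in> D \<and>
     distr M borel (\<lambda>\<omega>. Re (W (enn2real (exit_time W D \<omega>)) \<omega>)) = \<mu> \<and>
     (\<integral>\<^sup>+ \<omega>. exit_time W D \<omega> \<partial>M) < \<infinity>"

definition rate :: "'a measure \<Rightarrow> (real \<Rightarrow> 'a \<Rightarrow> complex) \<Rightarrow> complex set \<Rightarrow> real" where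
  "rate M W D =
     - Lim at_top (\<lambda>t::real. 1 / t * ln (measure M {\<omega> \<in> space M. exit_time W D \<omega> > ennreal t}))"

definition measure_support :: "real measure \<Rightarrow> real set" where
  "measure_support \<mu> = {x. \<forall>U. open U \<longrightarrow> x \<in> U \<longrightarrow> emeasure \<mu> U > 0}"

text \<open>Endpoints are extended reals, as the set may be unbounded.\<close>

definition smallest_interval :: "real set \<Rightarrow> ereal \<Rightarrow> ereal \<Rightarrow> bool" where
  "smallest_interval S \<alpha> \<beta> \<longleftrightarrow>
     ereal ` S \<subseteq> {\<alpha>..\<beta>} \<and> (\<forall>a b. ereal ` S \<subseteq> {a..b} \<longrightarrow> {\<alpha>..\<beta>} \<subseteq> {a..b})"

end

theory Submission
  imports Defs "HOL-Real_Asymp.Real_Asymp"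
begin

text \<open>
  Since $D$ is open, $\tau_D > t$ means that the path stays in $D$ during $[0,t]$, so everything is a
  statement about $p(t) = \mathbb{P}(W_r \in D \mbox{ for all } r \le t)$.

  \<^emph>\<open>The paths stay in the strip.\<close> As $\mathbb{E}\,\tau_D < \infty$, the real part of the stopped motion is
  a martingale bounded in $L^2$. Hence on $\{\tau_D > t\}$ the value $\mathrm{Re}\,W_t$ is the conditional
  expectation of $\mathrm{Re}\,W_{\tau_D}$ given the past, and the latter lies in $[\alpha,\beta]$ almost
  surely. So the surviving path lies in the strip $\alpha \le \mathrm{Re}\, z \le \beta$ almost surely at
  every time \<open>t\<close> (\<open>exit_bound_propagates\<close>).

  \<^emph>\<open>The strip forces decay.\<close> For $\theta < \pi/(\beta-\alpha)$ the function
  $\cos(\theta(x - (\alpha+\beta)/2))$ is bounded below by a positive constant on the strip and is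
  multiplied by $e^{-\theta^2 h/2}$ by the heat semigroup after time $h$. Observing the path at multiples
  of $h$, the mean of this function over the surviving paths shrinks in each step by at least the factor
  $e^{-\theta^2h/2} + O(h^2)$ (\<open>strip_decay\<close>); the error accounts for increments that carry the path to a
  region outside the strip where the cosine is negative, and these are bounded away from 0 in modulus. Letting first $h \to 0$ and then
  $\theta \to \pi/(\beta-\alpha)$ gives the bound (\<open>strip_rate\<close>).

  \<^emph>\<open>The rate exists.\<close> The inequality is about a limit, so its existence has to be proved. Write $u_t$
  for the density of $W_t$ on $\{\tau_D > t\}$. Reversibility makes $\int u_s u_t$ a function $a(s+t)$ of
  $s+t$ alone, and by the Cauchy-Schwarz inequality $a$ is log-convex. It has the same exponential order as
  $p$: on the one hand $a(s+t) \le p(s) \sup u_t$; on the other hand $p(t)$ is, up to a Gaussian tail, the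
  integral of $u_t$ over a disc of radius proportional to $t$, so $p(t)^2$ is at most a quadratic polynomial
  in $t$ times $a(2t)$, up to that tail. This is carried out for the walk $W_0, W_h, W_{2h}, \dots$ killed
  outside a closed set (\<open>grid_stay_supermultiplicative\<close>), where $u$ is an iterated Gaussian integral.
  The resulting inequality between survival probabilities no longer mentions densities and passes to the
  limit of finer grids and larger closed subsets of $D$ (\<open>survival_supermultiplicative\<close>); an elementary
  argument on real functions then yields the limit (\<open>exponential_rate_exists\<close>).
\<close>

section \<open>Gaussian densities on the plane\<close>

text \<open>
  The density of an increment of standard complex Brownian motion over a time span \<open>h\<close>.
\<close>

definition gauss :: "real \<Rightarrow> complex \<Rightarrow> real" where
  "gauss h z = exp (- (cmod z)\<^sup>2 / (2 * h)) / (2 * pi * h)"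

lemma gauss_measurable [measurable]: "gauss h \<in> borel_measurable borel"
  unfolding gauss_def by measurable

lemma gauss_nonneg: "0 < h \<Longrightarrow> 0 \<le> gauss h z"
  by (simp add: gauss_def)

lemma gauss_le: "0 < h \<Longrightarrow> gauss h z \<le> 1 / (2 * pi * h)"
  by (simp add: gauss_def field_simps)

lemma gauss_minus_commute: "gauss h (x - y) = gauss h (y - x)"
  by (simp add: gauss_def norm_minus_commute)

lemma measurable_Complex [measurable]: "(\<lambda>(x, y). Complex x y) \<in> borel \<Otimes>\<^sub>M borel \<rightarrow>\<^sub>M borel"
  unfolding borel_prod split_beta
  by (intro borel_measurable_continuous_onI continuous_intros)

text \<open>
  Identifies planar Lebesgue measure with a product of two linear ones, so that real parts of planar
  Gaussian variables can be computed with Fubini's theorem.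
\<close>

lemma lborel_complex_eq_distr:
  "(lborel :: complex measure) = distr (lborel \<Otimes>\<^sub>M lborel) borel (\<lambda>(x, y). Complex x y)"
proof (rule lborel_eqI)
  fix l u :: complex assume le: "\<And>b. b \<in> Basis \<Longrightarrow> l \<bullet> b \<le> u \<bullet> b"
  from le[of 1] le[of \<i>] have *: "Re l \<le> Re u" "Im l \<le> Im u" by (auto simp: Basis_complex_def)
  have pre: "(\<lambda>(x, y). Complex x y) -` box l u = {Re l<..<Re u} \<times> {Im l<..<Im u}"
    by (auto simp: in_box_complex_iff)
  have "emeasure (distr (lborel \<Otimes>\<^sub>M lborel) borel (\<lambda>(x, y). Complex x y)) (box l u)
     = emeasure (lborel \<Otimes>\<^sub>M lborel) ({Re l<..<Re u} \<times> {Im l<..<Im u})"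
    by (subst emeasure_distr) (auto simp: pre space_pair_measure)
  also have "\<dots> = emeasure lborel {Re l<..<Re u} * emeasure lborel {Im l<..<Im u}"
    by (subst lborel.emeasure_pair_measure_Times) auto
  also have "\<dots> = ennreal (\<Prod>b\<in>Basis. (u - l) \<bullet> b)"
    using * by (simp add: Basis_complex_def ennreal_mult)
  finally show "emeasure (distr (lborel \<Otimes>\<^sub>M lborel) borel (\<lambda>(x, y). Complex x y)) (box l u) = (\<Prod>b\<in>Basis. (u - l) \<bullet> b)" .
qed simp

lemma nn_integral_lborel_complex:
  fixes f :: "complex \<Rightarrow> ennreal"
  assumes [measurable]: "f \<in> borel_measurable borel"
  shows "(\<integral>\<^sup>+z. f z \<partial>lborel) = (\<integral>\<^sup>+x. \<integral>\<^sup>+y. f (Complex x y) \<partial>lborel \<partial>lborel)"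
proof -
  have "(\<integral>\<^sup>+z. f z \<partial>lborel) = (\<integral>\<^sup>+p. f (case p of (x, y) \<Rightarrow> Complex x y) \<partial>(lborel \<Otimes>\<^sub>M lborel))"
    by (subst lborel_complex_eq_distr, subst nn_integral_distr) auto
  also have "\<dots> = (\<integral>\<^sup>+x. \<integral>\<^sup>+y. f (Complex x y) \<partial>lborel \<partial>lborel)"
    by (subst lborel.nn_integral_fst[symmetric]) (auto simp: split_beta)
  finally show ?thesis .
qed

lemma gauss_Complex:
  assumes "0 < h"
  shows "gauss h (Complex x y) = normal_density 0 (sqrt h) x * normal_density 0 (sqrt h) y"
  using assms
  by (simp add: gauss_def normal_density_def cmod_power2 real_sqrt_mult exp_add[symmetric] field_simps
      flip: exp_add)

text \<open>
  The planar density is the product of two linear normal densities, and the one of the imaginary part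
  integrates to 1.
\<close>

lemma (in prob_space) distributed_Re_gauss:
  assumes X: "distributed M lborel X (\<lambda>z. ennreal (gauss h z))" and h: "0 < h"
  shows "distributed M lborel (\<lambda>\<omega>. Re (X \<omega>)) (normal_density 0 (sqrt h))"
proof -
  have Xm[measurable]: "X \<in> borel_measurable M"
    using distributed_measurable[OF X] by simp
  have "distr M lborel (\<lambda>\<omega>. Re (X \<omega>)) = density lborel (normal_density 0 (sqrt h))"
  proof (rule measure_eqI)
    fix B assume "B \<in> sets (distr M lborel (\<lambda>\<omega>. Re (X \<omega>)))"
    then have [measurable]: "B \<in> sets borel" by simp
    have "emeasure (distr M lborel (\<lambda>\<omega>. Re (X \<omega>))) B = emeasure M (X -` {z. Re z \<in> B} \<inter> space M)"
      by (subst emeasure_distr) (auto intro!: arg_cong[where f="emeasure M"])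
    also have "\<dots> = (\<integral>\<^sup>+z. ennreal (gauss h z) * indicator {z. Re z \<in> B} z \<partial>lborel)"
      by (rule distributed_emeasure[OF X]) simp
    also have "\<dots> = (\<integral>\<^sup>+x. \<integral>\<^sup>+y. ennreal (gauss h (Complex x y)) * indicator {z. Re z \<in> B} (Complex x y) \<partial>lborel \<partial>lborel)"
      by (rule nn_integral_lborel_complex) measurable
    also have "\<dots> = (\<integral>\<^sup>+x. \<integral>\<^sup>+y. ennreal (normal_density 0 (sqrt h) x) * indicator B x * ennreal (normal_density 0 (sqrt h) y) \<partial>lborel \<partial>lborel)"
      using h by (intro nn_integral_cong) (auto simp: gauss_Complex ennreal_mult indicator_def)
    also have "\<dots> = (\<integral>\<^sup>+x. ennreal (normal_density 0 (sqrt h) x) * indicator B x \<partial>lborel)"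
    proof (intro nn_integral_cong)
      fix x :: real
      have "(\<integral>\<^sup>+y. ennreal (normal_density 0 (sqrt h) y) \<partial>lborel) = 1"
        using prob_space.emeasure_space_1[OF prob_space_normal_density, of "sqrt h" 0] h
        by (simp add: emeasure_density)
      then show "(\<integral>\<^sup>+y. ennreal (normal_density 0 (sqrt h) x) * indicator B x * ennreal (normal_density 0 (sqrt h) y) \<partial>lborel) = ennreal (normal_density 0 (sqrt h) x) * indicator B x"
        by (subst nn_integral_cmult) auto
    qed
    also have "\<dots> = emeasure (density lborel (normal_density 0 (sqrt h))) B"
      by (simp add: emeasure_density)
    finally show "emeasure (distr M lborel (\<lambda>\<omega>. Re (X \<omega>))) B = emeasure (density lborel (normal_density 0 (sqrt h))) B" .
  qed simp
  then show ?thesis by (simp add: distributed_def)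
qed

lemma (in prob_space) gaussian_moments:
  assumes X: "distributed M lborel X (normal_density 0 (sqrt h))" and h: "0 < h"
  shows "integrable M X" "expectation X = 0"
    and "integrable M (\<lambda>\<omega>. (X \<omega>)\<^sup>2)" "expectation (\<lambda>\<omega>. (X \<omega>)\<^sup>2) = h"
    and "integrable M (\<lambda>\<omega>. (X \<omega>)^4)" "expectation (\<lambda>\<omega>. (X \<omega>)^4) = 3 * h\<^sup>2"
proof -
  have s: "0 < sqrt h" using h by simp
  have int: "integrable M (\<lambda>\<omega>. (X \<omega>)^k)" for k
    using integrable_normal_moment[of "sqrt h" 0 k] s
    by (subst distributed_integrable[OF X, symmetric]) (auto simp: )
  show "integrable M X" using int[of 1] by simp
  show "integrable M (\<lambda>\<omega>. (X \<omega>)\<^sup>2)" by (rule int)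
  show "integrable M (\<lambda>\<omega>. (X \<omega>)^4)" by (rule int)
  show E0: "expectation X = 0" by (rule normal_distributed_expectation[OF s X])
  show "expectation (\<lambda>\<omega>. (X \<omega>)\<^sup>2) = h"
    using normal_distributed_variance[OF s X] E0 h by simp
  have "expectation (\<lambda>\<omega>. (X \<omega>)^4) = (\<integral>x. normal_density 0 (sqrt h) x * x^4 \<partial>lborel)"
    by (subst distributed_integral[OF X, symmetric]) auto
  also have "\<dots> = fact 4 / ((2 / h)\<^sup>2 * fact 2)"
    using integral_normal_moment_even[of "sqrt h" 0 2] s h by simp
  also have "\<dots> = 3 * h\<^sup>2" using h by (simp add: fact_numeral field_simps)
  finally show "expectation (\<lambda>\<omega>. (X \<omega>)^4) = 3 * h\<^sup>2" .
qed

text \<open>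
  Cosines are eigenfunctions of the heat semigroup; the eigenvalue is the characteristic function of the
  normal distribution.
\<close>

lemma (in prob_space) gaussian_expectation_cos:
  assumes X: "distributed M lborel X (normal_density 0 (sqrt h))" and h: "0 < h"
  shows "expectation (\<lambda>\<omega>. cos (\<theta> * (x + X \<omega>))) = exp (- \<theta>\<^sup>2 * h / 2) * cos (\<theta> * x)"
proof -
  have s: "0 < sqrt h" using h by simp
  have Xm[measurable]: "X \<in> borel_measurable M"
    using distributed_measurable[OF X] by simp
  define Z where "Z = (\<lambda>\<omega>. X \<omega> / sqrt h)"
  have Z: "distributed M lborel Z std_normal_density"
    using normal_standard_normal_convert[OF s, of X 0] X by (simp add: Z_def)
  have Zm[measurable]: "Z \<in> borel_measurable M" unfolding Z_def by measurable
  have ZX: "sqrt h * Z \<omega> = X \<omega>" for \<omega> using s by (simp add: Z_def)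
  define t where "t = \<theta> * sqrt h"
  have "char (distr M lborel Z) t = (CLINT \<omega>|M. iexp (t * Z \<omega>))"
    by (simp add: char_def integral_distr)
  then have c: "(CLINT \<omega>|M. iexp (t * Z \<omega>)) = complex_of_real (exp (- t\<^sup>2 / 2))"
    by (simp add: distributed_distr_eq_density[OF Z] char_std_normal_distribution)
  have int: "integrable M (\<lambda>\<omega>. iexp (t * Z \<omega>))"
    by (rule integrable_const_bound[of _ 1]) auto
  have ci: "integrable M (\<lambda>\<omega>. cos (t * Z \<omega>))" "integrable M (\<lambda>\<omega>. sin (t * Z \<omega>))"
    by (rule integrable_const_bound[of _ 1]; simp)+
  have "expectation (\<lambda>\<omega>. cos (t * Z \<omega>)) = Re (CLINT \<omega>|M. iexp (t * Z \<omega>))"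
    by (subst integral_Re[OF int, symmetric]) (simp add: Re_exp)
  then have Ec: "expectation (\<lambda>\<omega>. cos (t * Z \<omega>)) = exp (- t\<^sup>2 / 2)" by (simp only: c Re_complex_of_real)
  have "expectation (\<lambda>\<omega>. sin (t * Z \<omega>)) = Im (CLINT \<omega>|M. iexp (t * Z \<omega>))"
    by (subst integral_Im[OF int, symmetric]) (simp add: Im_exp)
  then have Es: "expectation (\<lambda>\<omega>. sin (t * Z \<omega>)) = 0" by (simp only: c Im_complex_of_real)
  have "expectation (\<lambda>\<omega>. cos (\<theta> * (x + X \<omega>)))
     = expectation (\<lambda>\<omega>. cos (\<theta> * x) * cos (t * Z \<omega>) - sin (\<theta> * x) * sin (t * Z \<omega>))"
    by (intro Bochner_Integration.integral_cong)
       (auto simp: t_def ZX[symmetric] cos_add algebra_simps)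
  also have "\<dots> = cos (\<theta> * x) * exp (- t\<^sup>2 / 2)"
    using ci by (simp add: Ec Es)
  also have "\<dots> = exp (- \<theta>\<^sup>2 * h / 2) * cos (\<theta> * x)"
    using h by (simp add: t_def power_mult_distrib)
  finally show ?thesis .
qed

section \<open>The Markov property\<close>

context complex_brownian_motion
begin

text \<open>
  An intersection-stable generator of the past: finitely many constraints on the path up to time \<open>s\<close>.
\<close>

definition cylinders :: "real \<Rightarrow> 'a set set" where
  "cylinders s = {{\<omega> \<in> space M. \<forall>r\<in>R. W r \<omega> \<in> B r} | R B.
     finite R \<and> R \<subseteq> {0..s} \<and> (\<forall>r. B r \<in> sets (borel :: complex measure))}"

text \<open>
  Only the $\sigma$-algebra matters; it is packed into a measure so that measurability can refer to it.
\<close>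

definition past :: "real \<Rightarrow> 'a measure" where
  "past s = sigma (space M) (cylinders s)"

lemma W_event [measurable]: "0 \<le> r \<Longrightarrow> B \<in> sets borel \<Longrightarrow> {\<omega> \<in> space M. W r \<omega> \<in> B} \<in> events"
  using measurable_sets[OF measurable_W[of r], of B] by (simp add: vimage_def Int_def conj_commute)

lemma cylinders_events: "cylinders s \<subseteq> events"
proof
  fix E assume "E \<in> cylinders s"
  then obtain R B where R: "finite R" "R \<subseteq> {0..s}" "\<And>r. B r \<in> sets (borel :: complex measure)"
    and E: "E = {\<omega> \<in> space M. \<forall>r\<in>R. W r \<omega> \<in> B r}"
    by (auto simp: cylinders_def)
  show "E \<in> events" unfolding E
    using R by (intro sets.sets_Collect_finite_All' sets.sets_Collect_finite_All W_event) auto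
qed

lemma cylinders_Pow: "cylinders s \<subseteq> Pow (space M)"
  using cylinders_events sets.sets_into_space by blast

lemma space_past [simp]: "space (past s) = space M"
  by (simp add: past_def cylinders_Pow)

lemma sets_past: "sets (past s) = sigma_sets (space M) (cylinders s)"
  by (simp add: past_def cylinders_Pow)

lemma past_subset_events: "sets (past s) \<subseteq> events"
  unfolding sets_past using cylinders_events by (rule sets.sigma_sets_subset)

lemma measurable_past_imp_measurable: "X \<in> past s \<rightarrow>\<^sub>M N \<Longrightarrow> X \<in> M \<rightarrow>\<^sub>M N"
  using past_subset_events by (auto simp: measurable_def)

lemma Int_stable_cylinders: "Int_stable (cylinders s)"
proof (rule Int_stableI)
  fix a b assume "a \<in> cylinders s" "b \<in> cylinders s"
  then obtain R B R' B' where R: "finite R" "R \<subseteq> {0..s}" "\<And>r. B r \<in> sets (borel :: complex measure)"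
      "finite R'" "R' \<subseteq> {0..s}" "\<And>r. B' r \<in> sets (borel :: complex measure)"
    and E: "a = {\<omega> \<in> space M. \<forall>r\<in>R. W r \<omega> \<in> B r}" "b = {\<omega> \<in> space M. \<forall>r\<in>R'. W r \<omega> \<in> B' r}"
    by (auto simp: cylinders_def)
  let ?B = "\<lambda>r. (if r \<in> R then B r else UNIV) \<inter> (if r \<in> R' then B' r else UNIV)"
  have "a \<inter> b = {\<omega> \<in> space M. \<forall>r\<in>R \<union> R'. W r \<omega> \<in> ?B r}"
    unfolding E by auto
  then show "a \<inter> b \<in> cylinders s"
    unfolding cylinders_def mem_Collect_eq
    using R by (intro exI[of _ "R \<union> R'"] exI[of _ ?B]) auto
qed

lemma W_measurable_past: "0 \<le> r \<Longrightarrow> r \<le> s \<Longrightarrow> W r \<in> borel_measurable (past s)"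
proof (rule measurableI)
  fix A assume "0 \<le> r" "r \<le> s" "A \<in> sets (borel :: complex measure)"
  then have "{\<omega> \<in> space M. \<forall>r\<in>{r}. W r \<omega> \<in> A} \<in> cylinders s"
    unfolding cylinders_def mem_Collect_eq
    by (intro exI[of _ "{r}"] exI[of _ "\<lambda>_. A"]) auto
  moreover have "W r -` A \<inter> space (past s) = {\<omega> \<in> space M. \<forall>r\<in>{r}. W r \<omega> \<in> A}"
    by auto
  ultimately show "W r -` A \<inter> space (past s) \<in> sets (past s)"
    by (simp add: sets_past sigma_sets.Basic)
qed simp

lemma past_mono: "s \<le> t \<Longrightarrow> sets (past s) \<subseteq> sets (past t)"
  unfolding sets_past
proof (rule sigma_sets_mono', rule)
  fix E assume "s \<le> t" "E \<in> cylinders s"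
  then obtain R B where "finite R" "R \<subseteq> {0..s}" "\<And>r. B r \<in> sets (borel :: complex measure)"
    and E: "E = {\<omega> \<in> space M. \<forall>r\<in>R. W r \<omega> \<in> B r}"
    by (auto simp: cylinders_def)
  with \<open>s \<le> t\<close> show "E \<in> cylinders t"
    unfolding cylinders_def mem_Collect_eq by (intro exI[of _ R] exI[of _ B]) auto
qed

text \<open>
  A cylinder event is, up to the null event that the path does not start at 0, an event about the
  increments between the finitely many times involved, and these are independent of any later increment.
\<close>

lemma cylinder_increment_indep:
  assumes st: "0 \<le> s" "s < t" and E: "E \<in> cylinders s" and C: "C \<in> sets borel"
  shows "prob (E \<inter> {\<omega> \<in> space M. W t \<omega> - W s \<omega> \<in> C}) = prob E * prob {\<omega> \<in> space M. W t \<omega> - W s \<omega> \<in> C}"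
proof -
  obtain R B where R: "finite R" "R \<subseteq> {0..s}" "\<And>r. B r \<in> sets (borel :: complex measure)"
    and E: "E = {\<omega> \<in> space M. \<forall>r\<in>R. W r \<omega> \<in> B r}"
    using E by (auto simp: cylinders_def)
  \<comment> \<open>Adding 0 and s to the times makes 0 the first and s the last time of the list.\<close>
  define xs where "xs = sorted_list_of_set (insert 0 (insert s R))"
  have set_xs: "set xs = insert 0 (insert s R)" unfolding xs_def using R(1) by (intro set_sorted_list_of_set) simp
  have sorted: "sorted xs" by (simp add: xs_def)
  obtain n where n: "length xs = Suc n" using set_xs by (cases xs) auto
  define u where "u i = (if i < Suc n then xs ! i else t)" for i
  have u_le: "xs ! i \<le> s" "0 \<le> xs ! i" if "i < Suc n" for i
    using nth_mem[of i xs] that n R(2) st set_xs by auto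
  have mono: "mono u"
  proof (rule monoI)
    fix i j :: nat assume "i \<le> j"
    consider "j < Suc n" | "i < Suc n" "\<not> j < Suc n" | "\<not> i < Suc n" using \<open>i \<le> j\<close> by linarith
    then show "u i \<le> u j"
    proof cases
      case 1 then show ?thesis using sorted_nth_mono[OF sorted \<open>i \<le> j\<close>] n \<open>i \<le> j\<close> by (simp add: u_def)
    next
      case 2 then show ?thesis using u_le(1)[of i] st by (simp add: u_def)
    next
      case 3 then show ?thesis using \<open>i \<le> j\<close> by (simp add: u_def)
    qed
  qed
  have u0: "u 0 = 0"
  proof -
    have "0 \<in> set xs" by (simp add: set_xs)
    then obtain j where j: "j < Suc n" "xs ! j = 0" by (auto simp: in_set_conv_nth n)
    have "xs ! 0 \<le> 0" using sorted_nth_mono[OF sorted, of 0 j] j n by simp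
    with u_le[of 0] show ?thesis by (simp add: u_def)
  qed
  have un: "u n = s"
  proof -
    have "s \<in> set xs" by (simp add: set_xs)
    then obtain j where j: "j < Suc n" "xs ! j = s" by (auto simp: in_set_conv_nth n)
    have "s \<le> xs ! n" using sorted_nth_mono[OF sorted, of j n] j n by simp
    with u_le[of n] show ?thesis by (simp add: u_def)
  qed
  have ut: "u (Suc n) = t" by (simp add: u_def)
  define inc where "inc i \<omega> = W (u (Suc i)) \<omega> - W (u i) \<omega>" for i \<omega>
  have "\<exists>idx. \<forall>r\<in>R. idx r \<le> n \<and> u (idx r) = r"
  proof (rule bchoice, rule ballI)
    fix r assume "r \<in> R"
    then have "r \<in> set xs" by (simp add: set_xs)
    then obtain j where "j < Suc n" "xs ! j = r" by (auto simp: in_set_conv_nth n)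
    then show "\<exists>j. j \<le> n \<and> u j = r" by (auto simp: u_def intro!: exI[of _ j])
  qed
  then obtain idx where idx: "\<And>r. r \<in> R \<Longrightarrow> idx r \<le> n" "\<And>r. r \<in> R \<Longrightarrow> u (idx r) = r" by blast
  \<comment> \<open>The last of these increments, with index n, is the one from s to t; the others lie in the past.\<close>
  have "indep_vars (\<lambda>_. borel) inc {..<Suc n}"
    unfolding inc_def using mono u0 by (intro indep_increments) auto
  then have ind: "indep_var (PiM {..<n} (\<lambda>_. borel)) (\<lambda>\<omega>. restrict (\<lambda>i. inc i \<omega>) {..<n})
      (PiM {n} (\<lambda>_. borel)) (\<lambda>\<omega>. restrict (\<lambda>i. inc i \<omega>) {n})"
    by (rule indep_var_restrict) auto
  define S where "S = {v \<in> space (PiM {..<n} (\<lambda>_. borel :: complex measure)). \<forall>r\<in>R. (\<Sum>i<idx r. v i) \<in> B r}"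
  have S: "S \<in> sets (PiM {..<n} (\<lambda>_. borel))"
    unfolding S_def
  proof (intro sets.sets_Collect_finite_All R(1))
    fix r assume "r \<in> R"
    have "(\<lambda>v. \<Sum>i<idx r. v i) \<in> borel_measurable (PiM {..<n} (\<lambda>_. borel :: complex measure))"
      using idx(1)[OF \<open>r \<in> R\<close>] by (intro borel_measurable_sum measurable_component_singleton) auto
    from measurable_sets_Collect[OF this, of "\<lambda>z. z \<in> B r"] R(3)[of r]
    show "{v \<in> space (PiM {..<n} (\<lambda>_. borel :: complex measure)). (\<Sum>i<idx r. v i) \<in> B r} \<in> sets (PiM {..<n} (\<lambda>_. borel))"
      by simp
  qed
  have T: "{v \<in> space (PiM {n} (\<lambda>_. borel :: complex measure)). v n \<in> C} \<in> sets (PiM {n} (\<lambda>_. borel))" (is "?T \<in> _")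
    using C by measurable
  let ?V = "\<lambda>\<omega>. restrict (\<lambda>i. inc i \<omega>) {..<n}"
  let ?F = "{\<omega> \<in> space M. W t \<omega> - W s \<omega> \<in> C}"
  have Vm: "?V \<in> M \<rightarrow>\<^sub>M PiM {..<n} (\<lambda>_. borel)" using indep_var_rv1[OF ind] .
  have F: "(\<lambda>\<omega>. restrict (\<lambda>i. inc i \<omega>) {n}) -` ?T \<inter> space M = ?F"
    by (auto simp: inc_def un ut space_PiM)
  have E': "E \<in> events" using assms cylinders_events by blast
  have Fe: "?F \<in> events"
  proof -
    have [measurable]: "W t \<in> borel_measurable M" "W s \<in> borel_measurable M" using st by (auto intro: measurable_W)
    show ?thesis using C by measurable
  qed
  have VS: "?V -` S \<inter> space M \<in> events" using Vm S by (rule measurable_sets)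
  have AE_eq: "AE \<omega> in M. \<omega> \<in> E \<longleftrightarrow> \<omega> \<in> ?V -` S \<inter> space M"
    using start_at_0 AE_space
  proof eventually_elim
    case (elim \<omega>)
    have "(\<Sum>i<idx r. ?V \<omega> i) = W r \<omega>" if "r \<in> R" for r
    proof -
      have "(\<Sum>i<idx r. ?V \<omega> i) = (\<Sum>i<idx r. W (u (Suc i)) \<omega> - W (u i) \<omega>)"
        using idx(1)[OF that] by (intro sum.cong) (auto simp: inc_def)
      also have "\<dots> = W r \<omega>"
        using elim idx(2)[OF that] u0 sum_lessThan_telescope[of "\<lambda>i. W (u i) \<omega>" "idx r"] by simp
      finally show ?thesis .
    qed
    then show ?case using elim by (auto simp: E S_def space_PiM)
  qed
  have "prob (E \<inter> ?F) = prob ((?V -` S \<inter> space M) \<inter> ?F)"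
    using AE_eq E' VS Fe by (intro measure_eq_AE) (auto intro: sets.Int)
  also have "\<dots> = prob ((\<lambda>\<omega>. (?V \<omega>, restrict (\<lambda>i. inc i \<omega>) {n})) -` (S \<times> ?T) \<inter> space M)"
    unfolding F[symmetric] by (intro arg_cong[where f=prob]) auto
  also have "\<dots> = prob (?V -` S \<inter> space M) * prob ?F"
    unfolding indep_varD[OF ind S T] F ..
  also have "prob (?V -` S \<inter> space M) = prob E"
    using AE_eq E' VS by (intro measure_eq_AE) auto
  finally show ?thesis .
qed

abbreviation increment_events :: "real \<Rightarrow> real \<Rightarrow> 'a set set" where
  "increment_events s t \<equiv> {(\<lambda>\<omega>. W t \<omega> - W s \<omega>) -` A \<inter> space M |A. A \<in> sets borel}"

lemma past_indep_increment:
  assumes st: "0 \<le> s" "s < t"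
  shows "indep_set (sets (past s)) (sigma_sets (space M) (increment_events s t))"
proof -
  have Wm[measurable]: "W t \<in> borel_measurable M" "W s \<in> borel_measurable M"
    using st by (auto intro: measurable_W)
  have "indep_set (cylinders s) (increment_events s t)"
  proof (rule indep_setI[OF cylinders_events])
    show "increment_events s t \<subseteq> events" by auto
    fix a b assume a: "a \<in> cylinders s" and "b \<in> increment_events s t"
    then obtain C where C: "C \<in> sets (borel :: complex measure)" "b = (\<lambda>\<omega>. W t \<omega> - W s \<omega>) -` C \<inter> space M" by blast
    then have "b = {\<omega> \<in> space M. W t \<omega> - W s \<omega> \<in> C}" by auto
    with C(1) show "prob (a \<inter> b) = prob a * prob b"
      using cylinder_increment_indep[OF st a] by simp
  qed
  moreover have "Int_stable (increment_events s t)"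
  proof (rule Int_stableI)
    fix a b assume "a \<in> increment_events s t" "b \<in> increment_events s t"
    then obtain A B where AB: "A \<in> sets (borel :: complex measure)" "B \<in> sets (borel :: complex measure)"
      "a = (\<lambda>\<omega>. W t \<omega> - W s \<omega>) -` A \<inter> space M" "b = (\<lambda>\<omega>. W t \<omega> - W s \<omega>) -` B \<inter> space M" by blast
    then have "a \<inter> b = (\<lambda>\<omega>. W t \<omega> - W s \<omega>) -` (A \<inter> B) \<inter> space M" by auto
    then show "a \<inter> b \<in> increment_events s t" using AB by blast
  qed
  ultimately show ?thesis
    unfolding sets_past by (intro indep_set_sigma_sets Int_stable_cylinders)
qed

lemma distr_past_increment:
  assumes st: "0 \<le> s" "s < t" and X: "X \<in> past s \<rightarrow>\<^sub>M N"
  shows "distr M N X \<Otimes>\<^sub>M distr M borel (\<lambda>\<omega>. W t \<omega> - W s \<omega>)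
    = distr M (N \<Otimes>\<^sub>M borel) (\<lambda>\<omega>. (X \<omega>, W t \<omega> - W s \<omega>))"
proof -
  let ?I = "\<lambda>\<omega>. W t \<omega> - W s \<omega>"
  have Wm[measurable]: "W t \<in> borel_measurable M" "W s \<in> borel_measurable M"
    using st by (auto intro: measurable_W)
  have Xm[measurable]: "X \<in> M \<rightarrow>\<^sub>M N" by (rule measurable_past_imp_measurable[OF X])
  interpret X: prob_space "distr M N X" by (rule prob_space_distr) simp
  interpret I: prob_space "distr M borel ?I" by (rule prob_space_distr) simp
  show ?thesis
  proof (rule pair_measure_eqI)
    show "sigma_finite_measure (distr M N X)" "sigma_finite_measure (distr M borel ?I)" by unfold_locales
    show "sets (distr M N X \<Otimes>\<^sub>M distr M borel ?I) = sets (distr M (N \<Otimes>\<^sub>M borel) (\<lambda>\<omega>. (X \<omega>, ?I \<omega>)))"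
      by simp
    fix A B assume "A \<in> sets (distr M N X)" "B \<in> sets (distr M borel ?I)"
    then have AB: "A \<in> sets N" "B \<in> sets borel" by auto
    have "(\<lambda>\<omega>. (X \<omega>, ?I \<omega>)) -` (A \<times> B) \<inter> space M = (X -` A \<inter> space M) \<inter> (?I -` B \<inter> space M)" by auto
    moreover have "prob ((X -` A \<inter> space M) \<inter> (?I -` B \<inter> space M)) = prob (X -` A \<inter> space M) * prob (?I -` B \<inter> space M)"
      using measurable_sets[OF X AB(1)] AB(2)
      by (intro indep_setD[OF past_indep_increment[OF st]] sigma_sets.Basic) auto
    ultimately show "emeasure (distr M N X) A * emeasure (distr M borel ?I) B =
       emeasure (distr M (N \<Otimes>\<^sub>M borel) (\<lambda>\<omega>. (X \<omega>, ?I \<omega>))) (A \<times> B)"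
      using AB by (simp add: emeasure_distr emeasure_eq_measure ennreal_mult)
  qed
qed

lemma indep_var_past_Re_increment:
  fixes X :: "'a \<Rightarrow> real"
  assumes st: "0 \<le> s" "s < t" and X: "X \<in> borel_measurable (past s)"
  shows "indep_var borel X borel (\<lambda>\<omega>. Re (W t \<omega> - W s \<omega>))"
proof -
  have Wm[measurable]: "W t \<in> borel_measurable M" "W s \<in> borel_measurable M"
    using st by (auto intro: measurable_W)
  have 1: "sigma_sets (space M) {X -` A \<inter> space M |A. A \<in> sets borel} \<subseteq> sets (past s)"
    using measurable_sets[OF X] sets.sigma_sets_subset[of "{X -` A \<inter> space M |A. A \<in> sets borel}" "past s"]
    by auto
  have 2: "sigma_sets (space M) {(\<lambda>\<omega>. Re (W t \<omega> - W s \<omega>)) -` A \<inter> space M |A. A \<in> sets borel}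
      \<subseteq> sigma_sets (space M) (increment_events s t)"
  proof (rule sigma_sets_mono', rule)
    fix E assume "E \<in> {(\<lambda>\<omega>. Re (W t \<omega> - W s \<omega>)) -` A \<inter> space M |A. A \<in> sets borel}"
    then obtain A where A[measurable]: "A \<in> sets borel" and E: "E = (\<lambda>\<omega>. Re (W t \<omega> - W s \<omega>)) -` A \<inter> space M" by blast
    have "E = (\<lambda>\<omega>. W t \<omega> - W s \<omega>) -` (Re -` A) \<inter> space M" unfolding E by auto
    moreover have "Re -` A \<in> sets borel"
      using measurable_sets[of Re borel borel A] by simp
    ultimately show "E \<in> increment_events s t" by blast
  qed
  have "indep_set (sigma_sets (space M) {X -` A \<inter> space M |A. A \<in> sets borel})
    (sigma_sets (space M) {(\<lambda>\<omega>. Re (W t \<omega> - W s \<omega>)) -` A \<inter> space M |A. A \<in> sets borel})"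
    using past_indep_increment[OF st] 1 2 unfolding indep_sets2_eq by blast
  then show ?thesis
    using measurable_past_imp_measurable[OF X] by (auto simp: indep_var_eq)
qed

lemma increment_gauss:
  "0 \<le> s \<Longrightarrow> s < t \<Longrightarrow> distributed M lborel (\<lambda>\<omega>. W t \<omega> - W s \<omega>) (\<lambda>z. ennreal (gauss (t - s) z))"
  using gaussian_increments[of s t] by (simp add: gauss_def)

lemma W_gauss: assumes "0 < t" shows "distributed M lborel (W t) (\<lambda>z. ennreal (gauss t z))"
proof -
  have "distr M lborel (\<lambda>\<omega>. W t \<omega> - W 0 \<omega>) = distr M lborel (W t)"
    using assms start_at_0 measurable_W[of t] measurable_W[of 0]
    by (intro distr_cong_AE) auto
  then show ?thesis
    using increment_gauss[of 0 t] assms measurable_W[of t] by (simp add: distributed_def)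
qed

text \<open>
  The Markov property in the form used for one step of a walk: a later increment can be integrated out
  against its Gaussian density while everything determined by the past is kept fixed.
\<close>

lemma nn_integral_past_increment:
  assumes st: "0 \<le> s" "s < t" and X: "X \<in> past s \<rightarrow>\<^sub>M N"
    and F[measurable]: "F \<in> borel_measurable (N \<Otimes>\<^sub>M borel)"
  shows "(\<integral>\<^sup>+\<omega>. F (X \<omega>, W t \<omega> - W s \<omega>) \<partial>M) = (\<integral>\<^sup>+\<omega>. \<integral>\<^sup>+z. ennreal (gauss (t - s) z) * F (X \<omega>, z) \<partial>lborel \<partial>M)"
proof -
  have Wm[measurable]: "W t \<in> borel_measurable M" "W s \<in> borel_measurable M"
    using st by (auto intro: measurable_W)
  have Xm[measurable]: "X \<in> M \<rightarrow>\<^sub>M N" by (rule measurable_past_imp_measurable[OF X])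
  let ?I = "\<lambda>\<omega>. W t \<omega> - W s \<omega>"
  have d: "distr M N X \<Otimes>\<^sub>M distr M borel ?I = distr M (N \<Otimes>\<^sub>M borel) (\<lambda>\<omega>. (X \<omega>, ?I \<omega>))"
    by (rule distr_past_increment[OF st X])
  interpret I: prob_space "distr M borel ?I" by (rule prob_space_distr) simp
  have "(\<integral>\<^sup>+\<omega>. F (X \<omega>, ?I \<omega>) \<partial>M) = (\<integral>\<^sup>+p. F p \<partial>(distr M N X \<Otimes>\<^sub>M distr M borel ?I))"
    unfolding d by (subst nn_integral_distr) auto
  also have "\<dots> = (\<integral>\<^sup>+x. \<integral>\<^sup>+z. F (x, z) \<partial>distr M borel ?I \<partial>distr M N X)"
    by (rule I.nn_integral_fst[symmetric]) simp
  also have "\<dots> = (\<integral>\<^sup>+\<omega>. \<integral>\<^sup>+z. F (X \<omega>, z) \<partial>distr M borel ?I \<partial>M)"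
    by (rule nn_integral_distr) auto
  also have "\<dots> = (\<integral>\<^sup>+\<omega>. \<integral>\<^sup>+z. ennreal (gauss (t - s) z) * F (X \<omega>, z) \<partial>lborel \<partial>M)"
  proof (intro nn_integral_cong)
    fix \<omega> assume \<omega>: "\<omega> \<in> space M"
    then have Fm: "(\<lambda>z. F (X \<omega>, z)) \<in> borel_measurable borel"
      using measurable_space[OF Xm \<omega>] by measurable
    have "(\<integral>\<^sup>+z. F (X \<omega>, z) \<partial>distr M borel ?I) = (\<integral>\<^sup>+\<omega>'. F (X \<omega>, ?I \<omega>') \<partial>M)"
      by (rule nn_integral_distr) (use Fm in auto)
    also have "\<dots> = (\<integral>\<^sup>+z. ennreal (gauss (t - s) z) * F (X \<omega>, z) \<partial>lborel)"
      by (rule distributed_nn_integral[OF increment_gauss[OF st], symmetric]) (use Fm in simp)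
    finally show "(\<integral>\<^sup>+z. F (X \<omega>, z) \<partial>distr M borel ?I) = (\<integral>\<^sup>+z. ennreal (gauss (t - s) z) * F (X \<omega>, z) \<partial>lborel)" .
  qed
  finally show ?thesis .
qed

end

section \<open>Survival events and their approximation on dyadic grids\<close>

text \<open>
  The points at distance at least $1/(k+1)$ from the complement. These closed sets exhaust an open set in
  such a way that every compact subset is contained in one of them.
\<close>

definition inset :: "complex set \<Rightarrow> nat \<Rightarrow> complex set" where
  "inset D k = {z. \<forall>w. w \<notin> D \<longrightarrow> 1 / (real k + 1) \<le> dist z w}"

lemma closed_inset: "closed (inset D k)"
proof -
  have "inset D k = (\<Inter>w\<in>-D. {z. 1 / (real k + 1) \<le> dist z w})" by (auto simp: inset_def)
  also have "closed \<dots>" by (intro closed_INT ballI closed_Collect_le continuous_intros)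
  finally show ?thesis .
qed

lemma inset_mono: "k \<le> l \<Longrightarrow> inset D k \<subseteq> inset D l"
proof
  fix z assume "k \<le> l" "z \<in> inset D k"
  have "1 / (real l + 1) \<le> 1 / (real k + 1)" using \<open>k \<le> l\<close> by (intro divide_left_mono) auto
  with \<open>z \<in> inset D k\<close> show "z \<in> inset D l" unfolding inset_def by (blast intro: order_trans)
qed

lemma inset_subset: "inset D k \<subseteq> D"
proof
  fix z assume "z \<in> inset D k"
  moreover have "\<not> 1 / (real k + 1) \<le> dist z z" by (simp add: field_simps)
  ultimately show "z \<in> D" by (auto simp: inset_def)
qed

lemma compact_subset_inset:
  assumes "open D" "compact K" "K \<subseteq> D"
  obtains k where "K \<subseteq> inset D k"
proof -
  have "closed (- D)" "K \<inter> - D = {}" using assms by auto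
  from separate_compact_closed[OF assms(2) this]
  obtain d where d: "0 < d" "\<And>x y. x \<in> K \<Longrightarrow> y \<in> - D \<Longrightarrow> d \<le> dist x y" by blast
  obtain k where "inverse (real (Suc k)) < d" using reals_Archimedean[OF d(1)] by blast
  then have "1 / (real k + 1) \<le> d" by (simp add: inverse_eq_divide add.commute)
  then have "K \<subseteq> inset D k" unfolding inset_def using d(2) \<open>1 / (real k + 1) \<le> d\<close> by (blast intro: order_trans)
  then show thesis by (rule that)
qed

context complex_brownian_motion
begin

definition survive :: "complex set \<Rightarrow> real \<Rightarrow> 'a set" where
  "survive D t = {\<omega> \<in> space M. \<forall>r\<in>{0..t}. W r \<omega> \<in> D}"

definition grid_stay :: "complex set \<Rightarrow> real \<Rightarrow> nat \<Rightarrow> 'a set" where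
  "grid_stay A h n = {\<omega> \<in> space M. \<forall>j\<le>n. W (h * real j) \<omega> \<in> A}"

text \<open>
  The times at which the path is outside an open set form a closed set, so the infimum in the exit time is
  attained.
\<close>

lemma exit_time_gt_iff:
  assumes D: "open D" and \<omega>: "\<omega> \<in> space M" and t: "0 \<le> t"
  shows "ennreal t < exit_time W D \<omega> \<longleftrightarrow> (\<forall>r\<in>{0..t}. W r \<omega> \<in> D)"
proof
  assume gt: "ennreal t < exit_time W D \<omega>"
  show "\<forall>r\<in>{0..t}. W r \<omega> \<in> D"
  proof (rule ballI, rule ccontr)
    fix r assume r: "r \<in> {0..t}" "W r \<omega> \<notin> D"
    then have "exit_time W D \<omega> \<le> ennreal r" unfolding exit_time_def by (intro INF_lower) auto
    also have "\<dots> \<le> ennreal t" using r by (intro ennreal_leI) auto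
    finally show False using gt by simp
  qed
next
  assume stay: "\<forall>r\<in>{0..t}. W r \<omega> \<in> D"
  let ?S = "{r. 0 \<le> r \<and> W r \<omega> \<notin> D}"
  show "ennreal t < exit_time W D \<omega>"
  proof (cases "?S = {}")
    case True
    then show ?thesis unfolding exit_time_def by (simp only: True) simp
  next
    case False
    have "?S = {0..} \<inter> (\<lambda>r. W r \<omega>) -` (- D)" by auto
    moreover have "closed ({0..} \<inter> (\<lambda>r. W r \<omega>) -` (- D))"
      using D by (intro continuous_closed_preimage continuous_paths \<omega>) auto
    ultimately have "Inf ?S \<in> ?S"
      using False by (intro closed_contains_Inf) (auto intro!: bdd_belowI[of _ 0])
    then have "0 \<le> Inf ?S" "W (Inf ?S) \<omega> \<notin> D" by auto
    then have "t < Inf ?S" using stay by (meson atLeastAtMost_iff not_le)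
    moreover have "ennreal (Inf ?S) \<le> exit_time W D \<omega>"
      unfolding exit_time_def by (intro INF_greatest ennreal_leI cInf_lower) (auto intro!: bdd_belowI[of _ 0])
    ultimately show ?thesis using t by (rule_tac less_le_trans[of _ "ennreal (Inf ?S)"]) (auto simp: ennreal_less_iff)
  qed
qed

lemma survive_eq_exit_time:
  "open D \<Longrightarrow> 0 \<le> t \<Longrightarrow> {\<omega> \<in> space M. exit_time W D \<omega> > ennreal t} = survive D t"
  unfolding survive_def using exit_time_gt_iff by blast

lemma survive_anti: "s \<le> t \<Longrightarrow> survive D t \<subseteq> survive D s"
  by (auto simp: survive_def)

lemma grid_stay_past:
  assumes "0 \<le> h" "h * real n \<le> s" and A: "A \<in> sets borel"
  shows "grid_stay A h n \<in> sets (past s)"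
proof -
  have "W (h * real j) -` A \<inter> space M \<in> sets (past s)" if "j \<le> n" for j
  proof -
    have "h * real j \<le> h * real n" using assms(1) that by (simp add: mult_left_mono)
    then have "W (h * real j) \<in> borel_measurable (past s)"
      using assms(1,2) by (simp add: W_measurable_past)
    from measurable_sets[OF this A] show ?thesis by simp
  qed
  then have "(\<Inter>j\<in>{..n}. W (h * real j) -` A \<inter> space M) \<in> sets (past s)"
    by (intro sets.finite_INT) auto
  also have "(\<Inter>j\<in>{..n}. W (h * real j) -` A \<inter> space M) = grid_stay A h n"
    by (auto simp: grid_stay_def)
  finally show ?thesis .
qed

lemma grid_stay_events: "0 \<le> h \<Longrightarrow> A \<in> sets borel \<Longrightarrow> grid_stay A h n \<in> events"
  by (rule subsetD[OF past_subset_events grid_stay_past[OF _ order_refl]])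

text \<open>
  For a closed set, staying there at the dyadic times suffices by continuity. For the open domain itself
  this would be false, since a path may touch the complement at a single time; hence the detour through
  closed subsets.
\<close>

lemma dyadic_stay:
  assumes A: "closed A" and \<delta>: "0 \<le> \<delta>"
  shows "survive A (\<delta> * real n) = (\<Inter>m. grid_stay A (\<delta> / 2 ^ m) (n * 2 ^ m))"
proof (intro equalityI subsetI INT_I)
  fix \<omega> m assume "\<omega> \<in> survive A (\<delta> * real n)"
  then have \<omega>: "\<omega> \<in> space M" "\<And>r. r \<in> {0..\<delta> * real n} \<Longrightarrow> W r \<omega> \<in> A"
    by (auto simp: survive_def)
  have grid: "\<delta> / 2 ^ m * real j \<in> {0..\<delta> * real n}" if "j \<le> n * 2 ^ m" for j
  proof -
    have "real j \<le> real n * 2 ^ m" using that of_nat_mono[of j "n * 2 ^ m", where 'a=real] by simp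
    then have "\<delta> * real j \<le> \<delta> * (real n * 2 ^ m)" using \<delta> by (rule mult_left_mono)
    then show ?thesis using \<delta> by (simp add: field_simps)
  qed
  show "\<omega> \<in> grid_stay A (\<delta> / 2 ^ m) (n * 2 ^ m)"
    unfolding grid_stay_def mem_Collect_eq using \<omega> grid by blast
next
  fix \<omega> assume *: "\<omega> \<in> (\<Inter>m. grid_stay A (\<delta> / 2 ^ m) (n * 2 ^ m))"
  then have \<omega>: "\<omega> \<in> space M" by (auto simp: grid_stay_def)
  have "W r \<omega> \<in> A" if r: "r \<in> {0..\<delta> * real n}" for r
  proof -
    define j where "j m = nat \<lfloor>r * 2 ^ m / \<delta>\<rfloor>" for m :: nat
    have j1: "j m \<le> n * 2 ^ m" and j2: "\<delta> / 2 ^ m * real (j m) \<le> r" "r - \<delta> / 2 ^ m \<le> \<delta> / 2 ^ m * real (j m)" for m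
    proof -
      have "j m \<le> n * 2 ^ m \<and> \<delta> / 2 ^ m * real (j m) \<le> r \<and> r - \<delta> / 2 ^ m \<le> \<delta> / 2 ^ m * real (j m)"
      proof (cases "\<delta> = 0")
        case True then show ?thesis using r by (simp add: j_def)
      next
        case False
        then have d: "0 < \<delta>" using \<delta> by simp
        have "r * 2 ^ m \<le> (\<delta> * real n) * 2 ^ m" using r by (intro mult_right_mono) auto
        then have le: "r * 2 ^ m / \<delta> \<le> real (n * 2 ^ m)" using d by (simp add: field_simps)
        have ge: "0 \<le> r * 2 ^ m / \<delta>" using r d by simp
        have b: "real (j m) \<le> r * 2 ^ m / \<delta>" "r * 2 ^ m / \<delta> - 1 \<le> real (j m)"
          unfolding j_def using ge by linarith+
        then have "real (j m) \<le> real (n * 2 ^ m)" using le by linarith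
        then have "j m \<le> n * 2 ^ m" by (simp only: of_nat_le_iff)
        moreover have eq: "\<delta> / 2 ^ m * (r * 2 ^ m / \<delta>) = r" using d by simp
        moreover have "\<delta> / 2 ^ m * real (j m) \<le> \<delta> / 2 ^ m * (r * 2 ^ m / \<delta>)"
          by (rule mult_left_mono[OF b(1)]) (use d in simp)
        moreover have "\<delta> / 2 ^ m * (r * 2 ^ m / \<delta> - 1) \<le> \<delta> / 2 ^ m * real (j m)"
          by (rule mult_left_mono[OF b(2)]) (use d in simp)
        ultimately show ?thesis unfolding right_diff_distrib mult_1_right eq by (intro conjI)
      qed
      then show "j m \<le> n * 2 ^ m" "\<delta> / 2 ^ m * real (j m) \<le> r" "r - \<delta> / 2 ^ m \<le> \<delta> / 2 ^ m * real (j m)" by blast+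
    qed
    have "(\<lambda>m. \<delta> / 2 ^ m) \<longlonglongrightarrow> 0"
      using tendsto_mult_right_zero[OF LIMSEQ_power_zero[of "1/2::real"], of \<delta>] by (simp add: power_divide)
    from tendsto_diff[OF tendsto_const[of r] this]
    have "(\<lambda>m. r - \<delta> / 2 ^ m) \<longlonglongrightarrow> r" by simp
    then have lim: "(\<lambda>m. \<delta> / 2 ^ m * real (j m)) \<longlonglongrightarrow> r"
      using j2 by (intro tendsto_sandwich[OF _ _ \<open>(\<lambda>m. r - \<delta> / 2 ^ m) \<longlonglongrightarrow> r\<close> tendsto_const[of r]] always_eventually allI)
    have W_lim: "(\<lambda>m. W (\<delta> / 2 ^ m * real (j m)) \<omega>) \<longlonglongrightarrow> W r \<omega>"
      using r \<delta> by (intro continuous_on_tendsto_compose[OF continuous_paths[OF \<omega>] lim]) auto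
    have "W (\<delta> / 2 ^ m * real (j m)) \<omega> \<in> A" for m
      using INT_D[OF * UNIV_I, of m] j1[of m] unfolding grid_stay_def by blast
    then show ?thesis by (rule closed_sequentially[OF A _ W_lim])
  qed
  then show "\<omega> \<in> survive A (\<delta> * real n)" using \<omega> by (auto simp: survive_def)
qed

text \<open>
  The path up to time \<open>t\<close> is a compact subset of \<open>D\<close> when it survives.
\<close>

lemma survive_exhaust:
  assumes D: "open D"
  shows "survive D t = (\<Union>k. survive (inset D k) t)"
proof (intro equalityI subsetI)
  fix \<omega> assume \<omega>: "\<omega> \<in> survive D t"
  then have "compact ((\<lambda>r. W r \<omega>) ` {0..t})"
    by (intro compact_continuous_image continuous_on_subset[OF continuous_paths]) (auto simp: survive_def)
  moreover have "(\<lambda>r. W r \<omega>) ` {0..t} \<subseteq> D" using \<omega> by (auto simp: survive_def)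
  ultimately obtain k where "(\<lambda>r. W r \<omega>) ` {0..t} \<subseteq> inset D k" using compact_subset_inset[OF D] by metis
  with \<omega> show "\<omega> \<in> (\<Union>k. survive (inset D k) t)" by (auto simp: survive_def)
next
  fix \<omega> assume "\<omega> \<in> (\<Union>k. survive (inset D k) t)"
  then obtain k where "\<omega> \<in> survive (inset D k) t" by blast
  then show "\<omega> \<in> survive D t" using inset_subset[of D k] by (auto simp: survive_def)
qed

lemma survive_closed_past: "closed A \<Longrightarrow> 0 \<le> t \<Longrightarrow> survive A t \<in> sets (past t)"
proof -
  assume *: "closed A" "0 \<le> t"
  \<comment> \<open>Dividing the interval from 0 to t itself dyadically puts all grid times into the past of t.\<close>
  have "(\<Inter>m. grid_stay A (t / 2 ^ m) (1 * 2 ^ m)) \<in> sets (past t)"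
  proof (rule sets.countable_INT)
    show "range (\<lambda>m. grid_stay A (t / 2 ^ m) (1 * 2 ^ m)) \<subseteq> sets (past t)"
    proof (rule image_subsetI)
      fix m :: nat show "grid_stay A (t / 2 ^ m) (1 * 2 ^ m) \<in> sets (past t)"
        by (rule grid_stay_past) (use * in auto)
    qed
  qed simp
  then show ?thesis using dyadic_stay[OF *, of 1] by simp
qed

lemma survive_past: "open D \<Longrightarrow> 0 \<le> t \<Longrightarrow> survive D t \<in> sets (past t)"
  by (subst survive_exhaust, assumption, rule sets.countable_UN) (blast intro: survive_closed_past closed_inset)

lemma survive_events: "open D \<Longrightarrow> 0 \<le> t \<Longrightarrow> survive D t \<in> events"
  by (rule subsetD[OF past_subset_events survive_past])

lemma prob_grid_stay_tendsto:
  assumes "closed A" "0 \<le> \<delta>"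
  shows "(\<lambda>m. prob (grid_stay A (\<delta> / 2 ^ m) (n * 2 ^ m))) \<longlonglongrightarrow> prob (survive A (\<delta> * real n))"
  unfolding dyadic_stay[OF assms]
proof (rule finite_Lim_measure_decseq)
  show "range (\<lambda>m. grid_stay A (\<delta> / 2 ^ m) (n * 2 ^ m)) \<subseteq> events"
    using assms by (auto intro!: grid_stay_events)
  show "decseq (\<lambda>m. grid_stay A (\<delta> / 2 ^ m) (n * 2 ^ m))"
  proof (rule decseq_SucI, rule subsetI)
    fix m \<omega> assume *: "\<omega> \<in> grid_stay A (\<delta> / 2 ^ Suc m) (n * 2 ^ Suc m)"
    have "W (\<delta> / 2 ^ m * real j) \<omega> \<in> A" if "j \<le> n * 2 ^ m" for j
    proof -
      from * have "\<forall>i\<le>n * 2 ^ Suc m. W (\<delta> / 2 ^ Suc m * real i) \<omega> \<in> A" unfolding grid_stay_def by blast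
      moreover have "2 * j \<le> n * 2 ^ Suc m" using that by simp
      ultimately have "W (\<delta> / 2 ^ Suc m * real (2 * j)) \<omega> \<in> A" by blast
      then show ?thesis by simp
    qed
    with * show "\<omega> \<in> grid_stay A (\<delta> / 2 ^ m) (n * 2 ^ m)" by (auto simp: grid_stay_def)
  qed
qed

lemma prob_survive_inset_tendsto:
  assumes "open D" "0 \<le> t"
  shows "(\<lambda>k. prob (survive (inset D k) t)) \<longlonglongrightarrow> prob (survive D t)"
  unfolding survive_exhaust[OF assms(1)]
proof (rule finite_Lim_measure_incseq)
  show "range (\<lambda>k. survive (inset D k) t) \<subseteq> events"
    using subsetD[OF past_subset_events survive_closed_past[OF closed_inset assms(2)]] by blast
  show "incseq (\<lambda>k. survive (inset D k) t)"
  proof (rule incseq_SucI)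
    fix k show "survive (inset D k) t \<subseteq> survive (inset D (Suc k)) t"
      using inset_mono[of k "Suc k" D] by (auto simp: survive_def)
  qed
qed

text \<open>
  Supplies a time unit for which the limiting argument starts with a positive probability.
\<close>

lemma survive_initially:
  assumes D: "open D" "0 \<in> D"
  obtains \<delta> where "0 < \<delta>" "0 < prob (survive D (2 * \<delta>))"
proof -
  have "(\<lambda>n. prob (survive D (1 / real (Suc n)))) \<longlonglongrightarrow> prob (\<Union>n. survive D (1 / real (Suc n)))"
  proof (rule finite_Lim_measure_incseq)
    show "range (\<lambda>n. survive D (1 / real (Suc n))) \<subseteq> events"
      by (rule image_subsetI, rule survive_events[OF D(1)]) simp
    show "incseq (\<lambda>n. survive D (1 / real (Suc n)))"
      by (intro incseq_SucI survive_anti) (simp add: field_simps)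
  qed
  moreover have "prob (\<Union>n. survive D (1 / real (Suc n))) = 1"
  proof (subst prob_eq_1)
    show "(\<Union>n. survive D (1 / real (Suc n))) \<in> events"
      by (intro sets.countable_UN image_subsetI survive_events[OF D(1)]) simp
    show "AE \<omega> in M. \<omega> \<in> (\<Union>n. survive D (1 / real (Suc n)))"
      using start_at_0 AE_space
    proof eventually_elim
      case (elim \<omega>)
      then have "\<forall>r\<in>{0..0}. W r \<omega> \<in> D" using D by auto
      then have "0 < exit_time W D \<omega>" using exit_time_gt_iff[OF D(1) elim(2), of 0] by simp
      then obtain n where "ennreal (1 / real (Suc n)) < exit_time W D \<omega>"
      proof -
        obtain e where e: "0 < e" "ennreal e < exit_time W D \<omega>"
        proof -
          obtain y where y: "0 < y" "y < exit_time W D \<omega>" using dense[OF \<open>0 < exit_time W D \<omega>\<close>] by blast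
          then show thesis using that[of "enn2real y"] by (cases y) (auto simp: ennreal_less_zero_iff)
        qed
        obtain n where "inverse (real (Suc n)) < e" using reals_Archimedean[OF e(1)] by blast
        then have "ennreal (1 / real (Suc n)) < exit_time W D \<omega>"
          using e by (intro le_less_trans[OF ennreal_leI e(2)]) (simp add: inverse_eq_divide)
        then show ?thesis by (rule that)
      qed
      then have "\<omega> \<in> survive D (1 / real (Suc n))"
        using exit_time_gt_iff[OF D(1) elim(2), of "1 / real (Suc n)"] elim(2) by (simp add: survive_def)
      then show ?case by blast
    qed
  qed
  ultimately have "(\<lambda>n. prob (survive D (1 / real (Suc n)))) \<longlonglongrightarrow> 1" by simp
  from order_tendstoD(1)[OF this, of 0]
  have "eventually (\<lambda>n. 0 < prob (survive D (1 / real (Suc n)))) sequentially" by simp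
  then obtain n where "0 < prob (survive D (1 / real (Suc n)))"
    using eventually_happens trivial_limit_sequentially by blast
  moreover have "2 * (1 / real (Suc n) / 2) = 1 / real (Suc n)" by (simp add: field_simps)
  ultimately show thesis using that[of "1 / real (Suc n) / 2"] by simp
qed

end

section \<open>The random walk killed outside a set\<close>

text \<open>
  Log-convexity makes the quotients of consecutive terms increase, so the sequence dominates the geometric
  one with first quotient \<open>j 1 / j 0\<close>, which is at least \<open>j 1 / c\<close>.
\<close>

lemma log_convex_lower_bound:
  fixes j :: "nat \<Rightarrow> real"
  assumes nonneg: "\<And>k. 0 \<le> j k" and convex: "\<And>k. (j (Suc k))\<^sup>2 \<le> j k * j (Suc (Suc k))"
    and c: "0 < c" "j 0 \<le> c" and k: "1 \<le> k"
  shows "c * (j 1 / c) ^ k \<le> j k"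
proof (cases "j 1 = 0")
  case True then show ?thesis using k nonneg[of k] by (simp add: power_0_left)
next
  case False
  then have j1: "0 < j 1" using nonneg[of 1] by simp
  have step: "0 < j k \<and> j k * j 1 \<le> j (Suc k) * c" for k
  proof (induction k)
    case 0
    have "0 < (j 1)\<^sup>2" using j1 by simp
    then have "0 < j 0 * j 2" using convex[of 0] by (simp add: numeral_2_eq_2)
    then have "0 < j 0" using nonneg[of 0] nonneg[of 2] by (simp add: zero_less_mult_iff)
    then show ?case using c(2) j1 by (simp add: mult.commute mult_right_mono)
  next
    case (Suc k)
    have "0 < j k * j 1" using Suc j1 by simp
    then have "0 < j (Suc k) * c" using Suc by linarith
    then have pos: "0 < j (Suc k)" using c by (simp add: zero_less_mult_iff)
    have "j k * (j (Suc k) * j 1) = (j k * j 1) * j (Suc k)" by simp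
    also have "\<dots> \<le> (j (Suc k) * c) * j (Suc k)"
      using Suc pos by (intro mult_right_mono) auto
    also have "\<dots> = c * (j (Suc k))\<^sup>2" by (simp add: power2_eq_square)
    also have "\<dots> \<le> c * (j k * j (Suc (Suc k)))"
      using convex c by (intro mult_left_mono) auto
    finally have "j k * (j (Suc k) * j 1) \<le> j k * (j (Suc (Suc k)) * c)" by (simp add: mult_ac)
    then show ?case using Suc pos by simp
  qed
  from k show ?thesis
  proof (induction k rule: dec_induct)
    case base then show ?case using c by simp
  next
    case (step n)
    have "c * (j 1 / c) ^ Suc n = (c * (j 1 / c) ^ n) * (j 1 / c)" by simp
    also have "\<dots> \<le> j n * (j 1 / c)" using step j1 c by (intro mult_right_mono) auto
    also have "\<dots> \<le> j (Suc n)" using \<open>\<And>k. 0 < j k \<and> j k * j 1 \<le> j (Suc k) * c\<close>[of n] c by (simp add: field_simps)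
    finally show ?case .
  qed
qed

lemma nn_integral_lborel_translate:
  fixes f :: "complex \<Rightarrow> ennreal"
  assumes [measurable]: "f \<in> borel_measurable borel"
  shows "(\<integral>\<^sup>+z. f (x + z) \<partial>lborel) = (\<integral>\<^sup>+y. f y \<partial>lborel)"
  by (subst lborel_distr_plus[of x, symmetric], subst nn_integral_distr) auto

text \<open>
  The density at time \<open>h * (n + 1)\<close> of the walk with Gaussian steps of variance \<open>h\<close> started at 0 and killed
  outside \<open>A\<close>. The index is shifted by one step because the walk has no density at time 0.
\<close>

primrec killed_density :: "complex set \<Rightarrow> real \<Rightarrow> nat \<Rightarrow> complex \<Rightarrow> ennreal" where
  "killed_density A h 0 y = indicator A y * ennreal (gauss h y)"
| "killed_density A h (Suc n) y = indicator A y * (\<integral>\<^sup>+x. killed_density A h n x * ennreal (gauss h (y - x)) \<partial>lborel)"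

lemma killed_density_measurable [measurable]:
  assumes [measurable]: "A \<in> sets borel"
  shows "killed_density A h n \<in> borel_measurable borel"
proof (induction n)
  case 0 then show ?case unfolding killed_density.simps[abs_def] by measurable
next
  case (Suc n)
  note [measurable] = Suc
  show ?case unfolding killed_density.simps[abs_def]
    by measurable
qed

lemma killed_density_indicator: "indicator A y * killed_density A h n y = killed_density A h n y"
  by (cases n) (auto simp: indicator_def)

definition overlap :: "complex set \<Rightarrow> real \<Rightarrow> nat \<Rightarrow> nat \<Rightarrow> ennreal" where
  "overlap A h i j = (\<integral>\<^sup>+y. killed_density A h i y * killed_density A h j y \<partial>lborel)"

text \<open>
  The transition kernel of the killed walk is symmetric, so one step can be moved from one factor to the
  other.
\<close>

lemma overlap_shift:
  assumes [measurable]: "A \<in> sets borel"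
  shows "overlap A h (Suc i) j = overlap A h i (Suc j)"
proof -
  let ?v = "killed_density A h" and ?g = "\<lambda>x y. ennreal (gauss h (y - x))"
  have "overlap A h (Suc i) j = (\<integral>\<^sup>+y. (\<integral>\<^sup>+x. ?v i x * ?g x y * ?v j y \<partial>lborel) \<partial>lborel)"
    unfolding overlap_def
  proof (intro nn_integral_cong)
    fix y
    have "?v (Suc i) y * ?v j y = (\<integral>\<^sup>+x. ?v i x * ?g x y \<partial>lborel) * (indicator A y * ?v j y)"
      by (simp add: mult_ac)
    also have "\<dots> = (\<integral>\<^sup>+x. ?v i x * ?g x y * ?v j y \<partial>lborel)"
      unfolding killed_density_indicator by (subst nn_integral_multc) auto
    finally show "?v (Suc i) y * ?v j y = (\<integral>\<^sup>+x. ?v i x * ?g x y * ?v j y \<partial>lborel)" .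
  qed
  also have "\<dots> = (\<integral>\<^sup>+x. (\<integral>\<^sup>+y. ?v i x * ?g x y * ?v j y \<partial>lborel) \<partial>lborel)"
    by (rule lborel_pair.Fubini') measurable
  also have "\<dots> = overlap A h i (Suc j)"
    unfolding overlap_def
  proof (intro nn_integral_cong)
    fix x
    have "(\<integral>\<^sup>+y. ?v i x * ?g x y * ?v j y \<partial>lborel) = (\<integral>\<^sup>+y. ?v i x * (?v j y * ?g y x) \<partial>lborel)"
      by (intro nn_integral_cong) (simp add: mult_ac gauss_minus_commute)
    also have "\<dots> = ?v i x * (\<integral>\<^sup>+y. ?v j y * ?g y x \<partial>lborel)"
      by (rule nn_integral_cmult) measurable
    also have "\<dots> = (indicator A x * ?v i x) * (\<integral>\<^sup>+y. ?v j y * ?g y x \<partial>lborel)"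
      unfolding killed_density_indicator ..
    finally show "(\<integral>\<^sup>+y. ?v i x * ?g x y * ?v j y \<partial>lborel) = ?v i x * ?v (Suc j) x" by (simp add: mult_ac)
  qed
  finally show ?thesis .
qed

lemma overlap_eq_sum:
  assumes "A \<in> sets borel" "i + j = i' + j'"
  shows "overlap A h i j = overlap A h i' j'"
proof -
  have "overlap A h i j = overlap A h 0 (i + j)" for i j
    by (induction i arbitrary: j) (simp_all add: overlap_shift[OF assms(1)])
  then show ?thesis using assms(2) by metis
qed

lemma overlap_Cauchy_Schwarz:
  assumes [measurable]: "A \<in> sets borel"
  shows "(overlap A h i j)\<^sup>2 \<le> overlap A h i i * overlap A h j j"
  unfolding overlap_def
  using Cauchy_Schwarz_nn_integral[of "killed_density A h i" lborel "killed_density A h j"]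
  by (simp add: power2_eq_square)

context complex_brownian_motion
begin

lemma grid_stay_density:
  assumes h: "0 < h" and A[measurable]: "A \<in> sets borel" "0 \<in> A" and f: "f \<in> borel_measurable borel"
  shows "(\<integral>\<^sup>+\<omega>. f (W (h * real (Suc n)) \<omega>) * indicator (grid_stay A h (Suc n)) \<omega> \<partial>M)
    = (\<integral>\<^sup>+y. f y * killed_density A h n y \<partial>lborel)"
  using f
proof (induction n arbitrary: f)
  case 0
  note [measurable] = 0
  have AE: "AE \<omega> in M. f (W (h * real (Suc 0)) \<omega>) * indicator (grid_stay A h (Suc 0)) \<omega>
      = f (W h \<omega>) * indicator A (W h \<omega>)"
    using start_at_0 AE_space
  proof eventually_elim
    case (elim \<omega>)
    have "\<omega> \<in> grid_stay A h (Suc 0) \<longleftrightarrow> W h \<omega> \<in> A"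
      using elim A(2) by (auto simp: grid_stay_def le_Suc_eq)
    then show ?case by (simp add: indicator_def)
  qed
  have "(\<integral>\<^sup>+\<omega>. f (W (h * real (Suc 0)) \<omega>) * indicator (grid_stay A h (Suc 0)) \<omega> \<partial>M)
      = (\<integral>\<^sup>+\<omega>. f (W h \<omega>) * indicator A (W h \<omega>) \<partial>M)"
    using AE by (rule nn_integral_cong_AE)
  also have "\<dots> = (\<integral>\<^sup>+y. ennreal (gauss h y) * (f y * indicator A y) \<partial>lborel)"
    by (rule distributed_nn_integral[OF W_gauss[OF h], symmetric]) measurable
  also have "\<dots> = (\<integral>\<^sup>+y. f y * killed_density A h 0 y \<partial>lborel)" by (simp add: mult_ac)
  finally show ?case .
next
  case (Suc n)
  note fm[measurable] = Suc.prems
  let ?s = "h * real (Suc n)" and ?t = "h * real (Suc (Suc n))"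
  let ?G = "grid_stay A h (Suc n)"
  have st: "0 \<le> ?s" "?s < ?t" and d: "?t - ?s = h" using h by (auto simp: algebra_simps)
  have G: "?G \<in> sets (past ?s)" using h A by (intro grid_stay_past) auto
  define X where "X \<omega> = (W ?s \<omega>, indicator ?G \<omega> :: ennreal)" for \<omega>
  have X: "X \<in> past ?s \<rightarrow>\<^sub>M borel \<Otimes>\<^sub>M borel"
    unfolding X_def using G st by (intro measurable_Pair W_measurable_past) auto
  define F where "F p = (case p of ((x, b), z) \<Rightarrow> b * (f (x + z) * indicator A (x + z)))" for p :: "(complex \<times> ennreal) \<times> complex"
  have F[measurable]: "F \<in> borel_measurable ((borel \<Otimes>\<^sub>M borel) \<Otimes>\<^sub>M borel)"
    unfolding F_def by measurable
  define \<phi> where "\<phi> x = (\<integral>\<^sup>+y. f y * (indicator A y * ennreal (gauss h (y - x))) \<partial>lborel)" for x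
  have \<phi>m[measurable]: "\<phi> \<in> borel_measurable borel" unfolding \<phi>_def by measurable
  have "(\<integral>\<^sup>+\<omega>. f (W ?t \<omega>) * indicator (grid_stay A h (Suc (Suc n))) \<omega> \<partial>M)
      = (\<integral>\<^sup>+\<omega>. F (X \<omega>, W ?t \<omega> - W ?s \<omega>) \<partial>M)"
  proof (intro nn_integral_cong)
    fix \<omega> assume "\<omega> \<in> space M"
    then have "\<omega> \<in> grid_stay A h (Suc (Suc n)) \<longleftrightarrow> \<omega> \<in> ?G \<and> W ?t \<omega> \<in> A"
      by (auto simp: grid_stay_def le_Suc_eq)
    then show "f (W ?t \<omega>) * indicator (grid_stay A h (Suc (Suc n))) \<omega> = F (X \<omega>, W ?t \<omega> - W ?s \<omega>)"
      by (auto simp: F_def X_def indicator_def)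
  qed
  also have "\<dots> = (\<integral>\<^sup>+\<omega>. \<integral>\<^sup>+z. ennreal (gauss h z) * F (X \<omega>, z) \<partial>lborel \<partial>M)"
    using nn_integral_past_increment[OF st X F] unfolding d .
  also have "\<dots> = (\<integral>\<^sup>+\<omega>. \<phi> (W ?s \<omega>) * indicator ?G \<omega> \<partial>M)"
  proof (intro nn_integral_cong)
    fix \<omega>
    let ?x = "W ?s \<omega>"
    have "\<phi> ?x = (\<integral>\<^sup>+z. f (?x + z) * (indicator A (?x + z) * ennreal (gauss h (?x + z - ?x))) \<partial>lborel)"
      unfolding \<phi>_def by (rule nn_integral_lborel_translate[symmetric]) measurable
    then have "\<phi> ?x * indicator ?G \<omega> = (\<integral>\<^sup>+z. f (?x + z) * (indicator A (?x + z) * ennreal (gauss h z)) * indicator ?G \<omega> \<partial>lborel)"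
      by (subst nn_integral_multc) auto
    then show "(\<integral>\<^sup>+z. ennreal (gauss h z) * F (X \<omega>, z) \<partial>lborel) = \<phi> ?x * indicator ?G \<omega>"
      by (simp add: F_def X_def mult_ac)
  qed
  also have "\<dots> = (\<integral>\<^sup>+x. \<phi> x * killed_density A h n x \<partial>lborel)"
    by (rule Suc.IH) measurable
  also have "\<dots> = (\<integral>\<^sup>+x. \<integral>\<^sup>+y. f y * (indicator A y * ennreal (gauss h (y - x))) * killed_density A h n x \<partial>lborel \<partial>lborel)"
    unfolding \<phi>_def by (intro nn_integral_cong nn_integral_multc[symmetric]) measurable
  also have "\<dots> = (\<integral>\<^sup>+y. \<integral>\<^sup>+x. f y * (indicator A y * ennreal (gauss h (y - x))) * killed_density A h n x \<partial>lborel \<partial>lborel)"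
    by (rule lborel_pair.Fubini') measurable
  also have "\<dots> = (\<integral>\<^sup>+y. f y * killed_density A h (Suc n) y \<partial>lborel)"
  proof (intro nn_integral_cong)
    fix y
    have "(\<integral>\<^sup>+x. f y * (indicator A y * ennreal (gauss h (y - x))) * killed_density A h n x \<partial>lborel)
       = (\<integral>\<^sup>+x. (f y * indicator A y) * (killed_density A h n x * ennreal (gauss h (y - x))) \<partial>lborel)"
      by (simp add: mult_ac)
    also have "\<dots> = (f y * indicator A y) * (\<integral>\<^sup>+x. killed_density A h n x * ennreal (gauss h (y - x)) \<partial>lborel)"
      by (rule nn_integral_cmult) measurable
    finally show "(\<integral>\<^sup>+x. f y * (indicator A y * ennreal (gauss h (y - x))) * killed_density A h n x \<partial>lborel)
       = f y * killed_density A h (Suc n) y" by (simp add: mult_ac)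
  qed
  finally show ?case .
qed

lemma nn_integral_killed_density:
  assumes h: "0 < h" and A[measurable]: "A \<in> sets borel" "0 \<in> A"
  shows "(\<integral>\<^sup>+y. killed_density A h n y \<partial>lborel) = ennreal (prob (grid_stay A h (Suc n)))"
proof -
  have "grid_stay A h (Suc n) \<in> events" using h A by (intro grid_stay_events) auto
  then show ?thesis
    using grid_stay_density[OF h A, of "\<lambda>_. 1" n] by (simp add: emeasure_eq_measure)
qed

lemma nn_integral_killed_density_le:
  assumes h: "0 < h" and A[measurable]: "A \<in> sets borel" "0 \<in> A" and f[measurable]: "f \<in> borel_measurable borel"
  shows "(\<integral>\<^sup>+y. f y * killed_density A h n y \<partial>lborel) \<le> (\<integral>\<^sup>+y. ennreal (gauss (h * real (Suc n)) y) * f y \<partial>lborel)"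
proof -
  have "(\<integral>\<^sup>+y. f y * killed_density A h n y \<partial>lborel)
     = (\<integral>\<^sup>+\<omega>. f (W (h * real (Suc n)) \<omega>) * indicator (grid_stay A h (Suc n)) \<omega> \<partial>M)"
    by (rule grid_stay_density[OF h A f, symmetric])
  also have "\<dots> \<le> (\<integral>\<^sup>+\<omega>. f (W (h * real (Suc n)) \<omega>) \<partial>M)"
    by (intro nn_integral_mono) (auto simp: indicator_def)
  also have "\<dots> = (\<integral>\<^sup>+y. ennreal (gauss (h * real (Suc n)) y) * f y \<partial>lborel)"
    using h by (subst distributed_nn_integral[OF W_gauss]) auto
  finally show ?thesis .
qed

text \<open>
  Dropping the killing condition bounds the second factor by a Gaussian density, whose maximum is explicit.
\<close>

lemma overlap_le:
  assumes h: "0 < h" and A: "A \<in> sets borel" "0 \<in> A"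
  shows "overlap A h i j \<le> ennreal (1 / (2 * pi * (h * real (Suc j))) * prob (grid_stay A h (Suc i)))"
proof -
  let ?c = "1 / (2 * pi * (h * real (Suc j)))"
  have hj: "0 < h * real (Suc j)" using h by simp
  have "overlap A h i j \<le> (\<integral>\<^sup>+y. ennreal (gauss (h * real (Suc j)) y) * killed_density A h i y \<partial>lborel)"
    unfolding overlap_def using assms by (rule_tac nn_integral_killed_density_le) auto
  also have "\<dots> \<le> (\<integral>\<^sup>+y. ennreal ?c * killed_density A h i y \<partial>lborel)"
    using gauss_le[OF hj] by (intro nn_integral_mono mult_right_mono ennreal_leI) auto
  also have "\<dots> = ennreal ?c * ennreal (prob (grid_stay A h (Suc i)))"
    unfolding nn_integral_killed_density[OF assms, symmetric]
    by (rule nn_integral_cmult) (simp add: killed_density_measurable[OF A(1)])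
  also have "\<dots> = ennreal (?c * prob (grid_stay A h (Suc i)))"
    using h by (subst ennreal_mult) auto
  finally show ?thesis .
qed

text \<open>
  Markov's inequality for $e^{|W_t|^2/(4t)}$: weighting the density at time $t$ by this function turns it
  into twice the density at time $2t$, so the expectation is 2.
\<close>

lemma W_tail:
  assumes t: "0 < t" and \<rho>: "0 \<le> \<rho>"
  shows "prob {\<omega> \<in> space M. \<rho> < cmod (W t \<omega>)} \<le> 2 * exp (- \<rho>\<^sup>2 / (4 * t))"
proof -
  have Wm[measurable]: "W t \<in> borel_measurable M" using t by (intro measurable_W) auto
  let ?E = "{\<omega> \<in> space M. \<rho> < cmod (W t \<omega>)}"
  have "(\<integral>\<^sup>+z. ennreal (gauss (2 * t) z) \<partial>lborel) = 1"
    using distributed_nn_integral[OF W_gauss[of "2 * t"], of "\<lambda>_. 1"] t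
    by (simp add: emeasure_space_1)
  have "(\<integral>\<^sup>+\<omega>. ennreal (exp ((cmod (W t \<omega>))\<^sup>2 / (4 * t))) \<partial>M)
      = (\<integral>\<^sup>+z. ennreal (gauss t z) * ennreal (exp ((cmod z)\<^sup>2 / (4 * t))) \<partial>lborel)"
    by (rule distributed_nn_integral[OF W_gauss[OF t], symmetric]) measurable
  also have "\<dots> = (\<integral>\<^sup>+z. 2 * ennreal (gauss (2 * t) z) \<partial>lborel)"
  proof (intro nn_integral_cong)
    fix z
    have "gauss t z * exp ((cmod z)\<^sup>2 / (4 * t)) = exp (- (cmod z)\<^sup>2 / (2 * t) + (cmod z)\<^sup>2 / (4 * t)) / (2 * pi * t)"
      unfolding gauss_def exp_add by simp
    also have "- (cmod z)\<^sup>2 / (2 * t) + (cmod z)\<^sup>2 / (4 * t) = - (cmod z)\<^sup>2 / (2 * (2 * t))"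
      using t by (simp add: field_simps)
    also have "exp (- (cmod z)\<^sup>2 / (2 * (2 * t))) / (2 * pi * t) = 2 * gauss (2 * t) z"
      using t by (simp add: gauss_def)
    finally have "ennreal (gauss t z * exp ((cmod z)\<^sup>2 / (4 * t))) = ennreal (2 * gauss (2 * t) z)" by simp
    then show "ennreal (gauss t z) * ennreal (exp ((cmod z)\<^sup>2 / (4 * t))) = 2 * ennreal (gauss (2 * t) z)"
      using t gauss_nonneg[of t z] gauss_nonneg[of "2 * t" z] by (simp add: ennreal_mult)
  qed
  also have "\<dots> = 2"
    using \<open>(\<integral>\<^sup>+z. ennreal (gauss (2 * t) z) \<partial>lborel) = 1\<close> by (subst nn_integral_cmult) auto
  finally have mgf: "(\<integral>\<^sup>+\<omega>. ennreal (exp ((cmod (W t \<omega>))\<^sup>2 / (4 * t))) \<partial>M) = 2" .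
  have "ennreal (exp (\<rho>\<^sup>2 / (4 * t)) * prob ?E) = (\<integral>\<^sup>+\<omega>. ennreal (exp (\<rho>\<^sup>2 / (4 * t))) * indicator ?E \<omega> \<partial>M)"
    by (subst nn_integral_cmult_indicator) (auto simp: emeasure_eq_measure ennreal_mult)
  also have "\<dots> \<le> (\<integral>\<^sup>+\<omega>. ennreal (exp ((cmod (W t \<omega>))\<^sup>2 / (4 * t))) \<partial>M)"
    using t \<rho>
    by (intro nn_integral_mono) (auto simp: indicator_def intro!: ennreal_leI divide_right_mono power_mono)
  also have "\<dots> = ennreal 2" unfolding mgf by simp
  finally have "exp (\<rho>\<^sup>2 / (4 * t)) * prob ?E \<le> 2"
    by (subst (asm) ennreal_le_iff) auto
  then show ?thesis by (simp add: exp_minus field_simps)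
qed

text \<open>
  On a disc the integral of the killed density is controlled by its $L^2$ norm and the area; outside the disc
  the Gaussian tail takes over.
\<close>

lemma grid_stay_le_overlap:
  assumes h: "0 < h" and A[measurable]: "A \<in> sets borel" "0 \<in> A" and \<rho>: "0 \<le> \<rho>"
    and fin: "overlap A h n n = ennreal J" "0 \<le> J"
  shows "(max 0 (prob (grid_stay A h (Suc n)) - 2 * exp (- \<rho>\<^sup>2 / (4 * (h * real (Suc n))))))\<^sup>2 \<le> pi * \<rho>\<^sup>2 * J"
proof -
  let ?t = "h * real (Suc n)" and ?G = "grid_stay A h (Suc n)" and ?B = "cball 0 \<rho> :: complex set"
  have t: "0 < ?t" using h by simp
  have Wm[measurable]: "W ?t \<in> borel_measurable M" using t by (intro measurable_W) auto
  have G[measurable]: "?G \<in> events" using h A by (intro grid_stay_events) auto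
  define H where "H = ?G \<inter> {\<omega> \<in> space M. cmod (W ?t \<omega>) \<le> \<rho>}"
  have H: "H \<in> events" unfolding H_def by measurable
  have B: "(indicator ?B :: complex \<Rightarrow> ennreal) \<in> borel_measurable borel"
    by (intro borel_measurable_indicator borel_closed closed_cball)
  have T: "{\<omega> \<in> space M. \<rho> < cmod (W ?t \<omega>)} \<in> events" by measurable
  have "?G \<subseteq> H \<union> {\<omega> \<in> space M. \<rho> < cmod (W ?t \<omega>)}"
    unfolding H_def using sets.sets_into_space[OF G] by auto
  then have "prob ?G \<le> prob (H \<union> {\<omega> \<in> space M. \<rho> < cmod (W ?t \<omega>)})"
    using sets.Un[OF H T] by (rule finite_measure_mono)
  also have "\<dots> \<le> prob H + prob {\<omega> \<in> space M. \<rho> < cmod (W ?t \<omega>)}"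
    by (rule measure_Un_le[OF H T])
  also have "\<dots> \<le> prob H + 2 * exp (- \<rho>\<^sup>2 / (4 * ?t))"
    using W_tail[OF t \<rho>] by simp
  finally have le: "max 0 (prob ?G - 2 * exp (- \<rho>\<^sup>2 / (4 * ?t))) \<le> prob H" by simp
  have "ennreal (prob H) = (\<integral>\<^sup>+\<omega>. indicator ?B (W ?t \<omega>) * indicator ?G \<omega> \<partial>M)"
  proof -
    have "(\<integral>\<^sup>+\<omega>. indicator ?B (W ?t \<omega>) * indicator ?G \<omega> \<partial>M) = (\<integral>\<^sup>+\<omega>. indicator H \<omega> \<partial>M)"
      by (intro nn_integral_cong) (auto simp: H_def indicator_def)
    then show ?thesis using H by (simp add: emeasure_eq_measure)
  qed
  also have "\<dots> = (\<integral>\<^sup>+y. indicator ?B y * killed_density A h n y \<partial>lborel)"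
    by (rule grid_stay_density[OF h A B])
  finally have "(ennreal (prob H))\<^sup>2 = (\<integral>\<^sup>+y. indicator ?B y * killed_density A h n y \<partial>lborel)\<^sup>2" by simp
  also have "\<dots> \<le> (\<integral>\<^sup>+y. (indicator ?B y)\<^sup>2 \<partial>lborel) * (\<integral>\<^sup>+y. (killed_density A h n y)\<^sup>2 \<partial>lborel)"
    using B by (intro Cauchy_Schwarz_nn_integral) auto
  also have "(\<integral>\<^sup>+y. (killed_density A h n y)\<^sup>2 \<partial>lborel) = ennreal J"
    using fin by (simp add: overlap_def power2_eq_square)
  also have "(\<integral>\<^sup>+y. (indicator ?B y)\<^sup>2 \<partial>lborel) = (\<integral>\<^sup>+y. indicator ?B y \<partial>lborel)"
    by (intro nn_integral_cong) (auto simp: indicator_def)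
  also have "\<dots> = emeasure lborel ?B" by simp
  also have "\<dots> = ennreal (pi * \<rho>\<^sup>2)"
    using \<rho> by (simp add: emeasure_cball unit_ball_vol_2)
  finally have "ennreal ((prob H)\<^sup>2) \<le> ennreal (pi * \<rho>\<^sup>2 * J)"
    using fin by (simp add: ennreal_mult ennreal_power)
  then have "(prob H)\<^sup>2 \<le> pi * \<rho>\<^sup>2 * J" using fin by (subst (asm) ennreal_le_iff) auto
  moreover have "(max 0 (prob ?G - 2 * exp (- \<rho>\<^sup>2 / (4 * ?t))))\<^sup>2 \<le> (prob H)\<^sup>2"
    using le by (intro power_mono) auto
  ultimately show ?thesis by linarith
qed

text \<open>
  Survival for \<open>K + L\<close> steps bounds survival for \<open>K + 2 * k * L\<close> steps from below. The overlaps of total time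
  $2(K + kL)$ form a log-convex sequence in $k$; the first one is bounded by the Gaussian maximum at time
  $hK$, the second one from below by survival for $K+L$ steps, and the $k$-th one from above by survival for
  $K + 2kL$ steps. The first $K$ steps are only there to smooth the starting point.
\<close>

lemma grid_stay_supermultiplicative:
  assumes h: "0 < h" and A: "A \<in> sets borel" "0 \<in> A" and \<rho>: "0 < \<rho>" and K: "1 \<le> K" and k: "1 \<le> k"
  shows "((max 0 (prob (grid_stay A h (K + L)) - 2 * exp (- \<rho>\<^sup>2 / (4 * (h * real (K + L))))))\<^sup>2
      / (\<rho>\<^sup>2 / (2 * (h * real K)))) ^ k \<le> prob (grid_stay A h (K + 2 * k * L))"
proof -
  obtain a where a: "K = Suc a" using K by (cases K) auto
  define c where "c = 1 / (2 * pi * (h * real K))"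
  have c: "0 < c" using h K by (simp add: c_def)
  define j where "j k = enn2real (overlap A h (a + k * L) (a + k * L))" for k
  have fin: "overlap A h i i' < \<infinity>" for i i'
    using overlap_le[OF h A, of i i'] by (rule le_less_trans) simp
  have ov: "overlap A h i i' = ennreal (j k)" if "i + i' = 2 * (a + k * L)" for i i' k
  proof -
    have "overlap A h i i' = overlap A h (a + k * L) (a + k * L)"
      using that by (intro overlap_eq_sum A) simp
    then show ?thesis using fin by (simp add: j_def)
  qed
  have j0: "0 \<le> j k" for k by (simp add: j_def)
  have convex: "(j (Suc k))\<^sup>2 \<le> j k * j (Suc (Suc k))" for k
  proof -
    have "(overlap A h (a + k * L) (a + Suc (Suc k) * L))\<^sup>2 \<le> overlap A h (a + k * L) (a + k * L)
        * overlap A h (a + Suc (Suc k) * L) (a + Suc (Suc k) * L)"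
      by (rule overlap_Cauchy_Schwarz[OF A(1)])
    moreover have "overlap A h (a + k * L) (a + Suc (Suc k) * L) = ennreal (j (Suc k))"
      by (rule ov) (simp add: algebra_simps)
    moreover have "overlap A h (a + k * L) (a + k * L) = ennreal (j k)" by (rule ov) simp
    moreover have "overlap A h (a + Suc (Suc k) * L) (a + Suc (Suc k) * L) = ennreal (j (Suc (Suc k)))"
      by (rule ov) simp
    ultimately have "ennreal ((j (Suc k))\<^sup>2) \<le> ennreal (j k * j (Suc (Suc k)))"
      using j0 by (simp add: ennreal_mult ennreal_power)
    then show ?thesis using j0 by (subst (asm) ennreal_le_iff) auto
  qed
  have j_le: "j k \<le> c * prob (grid_stay A h (K + 2 * k * L))" for k
  proof -
    have "ennreal (j k) = overlap A h (a + 2 * k * L) a" by (rule ov[symmetric]) simp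
    also have "\<dots> \<le> ennreal (c * prob (grid_stay A h (K + 2 * k * L)))"
      using overlap_le[OF h A, of "a + 2 * k * L" a] by (simp add: c_def a)
    finally show ?thesis using c by (subst (asm) ennreal_le_iff) auto
  qed
  have "c * prob (grid_stay A h K) \<le> c * 1" using c by (intro mult_left_mono prob_le_1) auto
  then have "j 0 \<le> c" using j_le[of 0] by simp
  have "c * (j 1 / c) ^ k \<le> j k"
    by (rule log_convex_lower_bound[of j, OF j0 convex c \<open>j 0 \<le> c\<close> k])
  also have "\<dots> \<le> c * prob (grid_stay A h (K + 2 * k * L))" by (rule j_le)
  finally have main: "(j 1 / c) ^ k \<le> prob (grid_stay A h (K + 2 * k * L))" using c by simp
  let ?m = "max 0 (prob (grid_stay A h (K + L)) - 2 * exp (- \<rho>\<^sup>2 / (4 * (h * real (K + L)))))"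
  have "?m\<^sup>2 \<le> pi * \<rho>\<^sup>2 * j 1"
    using grid_stay_le_overlap[OF h A less_imp_le[OF \<rho>], of "a + L" "j 1"] ov[of "a + L" "a + L" 1] j0[of 1]
    by (simp add: a)
  then have "?m\<^sup>2 / (\<rho>\<^sup>2 / (2 * (h * real K))) \<le> (pi * \<rho>\<^sup>2 * j 1) / (\<rho>\<^sup>2 / (2 * (h * real K)))"
    using h by (intro divide_right_mono) auto
  also have "\<dots> = j 1 / c" using \<rho> h K by (simp add: c_def field_simps)
  finally have "(?m\<^sup>2 / (\<rho>\<^sup>2 / (2 * (h * real K)))) ^ k \<le> (j 1 / c) ^ k"
    using h by (intro power_mono) auto
  with main show ?thesis by linarith
qed

end

section \<open>Existence of the exponential rate\<close>

text \<open>
  A substitute for Fekete's lemma. The hypothesis says that $p(t)^{2k}$, up to the $k$-th power of a polynomial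
  factor and an exponentially small error, bounds $p$ at about the time $2kt$ from below.
  Applied with \<open>n = 1\<close> it gives an exponential lower bound for \<open>p\<close>, after which the parameter \<open>R\<close> can be
  fixed so large that the error term is always harmless. What remains is the inequality
  $l(1 + 2kn) \le 2kn\,a(n)$ for $l(m) = -\ln p(\delta m)$, where $a(n)$ differs from $l(n+1)/n$ by
  $O(\ln n / n)$; both the upper and the lower limit of $l(m)/m$ are then the infimum of $a$.
\<close>

lemma exponential_rate_exists:
  fixes p :: "real \<Rightarrow> real"
  assumes \<delta>: "0 < \<delta>"
    and anti: "\<And>s t. 0 \<le> s \<Longrightarrow> s \<le> t \<Longrightarrow> p t \<le> p s"
    and le1: "\<And>t. 0 \<le> t \<Longrightarrow> p t \<le> 1"
    and pos2: "0 < p (2 * \<delta>)"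
    and key: "\<And>(n::nat) (k::nat) R. 1 \<le> n \<Longrightarrow> 1 \<le> k \<Longrightarrow> 0 < R \<Longrightarrow>
        2 * exp (- R * (1 + real n)) \<le> p (\<delta> * (1 + real n)) \<Longrightarrow>
        ((p (\<delta> * (1 + real n)) - 2 * exp (- R * (1 + real n)))\<^sup>2 / (2 * R * (1 + real n)\<^sup>2)) ^ k
          \<le> p (\<delta> * (1 + 2 * real k * real n))"
  shows "\<exists>L\<ge>0. ((\<lambda>t. 1 / t * ln (p t)) \<longlongrightarrow> - L) at_top \<and> (\<forall>t\<ge>0. 0 < p t)"
proof -
  define P where "P n = p (\<delta> * real n)" for n :: nat
  have P_anti: "P n \<le> P m" if "m \<le> n" for m n
    unfolding P_def using \<delta> that by (intro anti) auto
  have P_le1: "P n \<le> 1" for n unfolding P_def using \<delta> by (intro le1) auto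
  have P2: "0 < P 2" using pos2 by (simp add: P_def mult.commute)
  have keyP: "((P (1 + n) - 2 * exp (- R * (1 + real n)))\<^sup>2 / (2 * R * (1 + real n)\<^sup>2)) ^ k \<le> P (1 + 2 * k * n)"
    if "1 \<le> n" "1 \<le> k" "0 < R" "2 * exp (- R * (1 + real n)) \<le> P (1 + n)" for n k R
    using key[of n k R] that by (simp add: P_def)

  obtain c where c: "0 < c" "c \<le> 1/2" "\<And>n. 1 \<le> n \<Longrightarrow> c ^ n \<le> P n"
  proof -
    \<comment> \<open>This choice makes the error term for n = 1 equal to (P 2)^2 / 8, which is smaller than P 2.\<close>
    define R where "R = ln (4 / P 2)"
    have R: "0 < R" using P2 P_le1[of 2] by (auto simp: R_def intro!: ln_gt_zero)
    have eR2: "exp (- R) = P 2 / 4" using P2 by (simp add: R_def exp_minus)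
    then have ex: "exp (- R * 2) = (P 2 / 4)\<^sup>2"
      using exp_double[of "- R"] unfolding eR2 by (simp add: mult.commute)
    have lt: "2 * exp (- R * 2) < P 2"
    proof -
      have "P 2 * P 2 \<le> 1 * P 2" using P2 P_le1[of 2] by (intro mult_right_mono) auto
      then show ?thesis unfolding ex using P2 by (simp add: power2_eq_square)
    qed
    define c0 where "c0 = (P 2 - 2 * exp (- R * 2))\<^sup>2 / (8 * R)"
    have c0: "0 < c0" using lt R by (simp add: c0_def)
    have "c0 ^ k \<le> P (1 + 2 * k)" if "1 \<le> k" for k
      using keyP[of 1 k R, unfolded one_add_one] that R lt by (simp add: c0_def)
    then have c0P: "c0 ^ k \<le> P k" if "1 \<le> k" for k
      using P_anti[of k "1 + 2 * k"] that by (rule_tac order_trans[of _ "P (1 + 2 * k)"]) auto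
    have min_c0: "min c0 (1/2) ^ k \<le> c0 ^ k" for k using c0 by (intro power_mono) auto
    have "min c0 (1/2) ^ k \<le> P k" if "1 \<le> k" for k
      using min_c0[of k] c0P[OF that] by linarith
    then show thesis using c0 by (intro that[of "min c0 (1/2)"]) auto
  qed

  \<comment> \<open>Now the error term is at most half of P (1 + n) for every n.\<close>
  define R where "R = ln (4 / c)"
  have "1 \<le> R"
  proof -
    have "exp (1::real) \<le> 3" by (rule exp_le)
    moreover have "8 \<le> 4 / c" using c by (simp add: field_simps)
    ultimately have "exp 1 \<le> 4 / c" by simp
    then show ?thesis unfolding R_def using c by (subst ln_ge_iff) auto
  qed
  then have R: "0 < R" "1 \<le> 8 * R" by auto
  have eR: "exp (- R) = c / 4" using c by (simp add: R_def exp_minus)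
  define e where "e x = ln (8 * R * x\<^sup>2) / 2" for x :: real
  define l where "l n = - ln (P n)" for n
  define a where "a n = (l (1 + n) + e (1 + real n)) / real n" for n :: nat
  have P_pos: "0 < P n" for n 
    using c(3)[of "Suc n"] zero_less_power[OF c(1), of "Suc n"] P_anti[of n "Suc n"] by linarith
  have l_nonneg: "0 \<le> l n" for n unfolding l_def using P_pos[of n] P_le1[of n] by simp
  have e_nonneg: "0 \<le> e x" if "1 \<le> x" for x
  proof -
    have "1 * 1 \<le> 8 * R * x\<^sup>2" using R that by (intro mult_mono) (auto simp: one_le_power)
    then show ?thesis by (simp add: e_def)
  qed
  have a_nonneg: "0 \<le> a n" for n
    unfolding a_def using l_nonneg[of "1+n"] e_nonneg[of "1 + real n"] by (intro divide_nonneg_nonneg add_nonneg_nonneg) auto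
  have l_le: "l (1 + 2 * k * n) \<le> (2 * real k * real n) * a n" if n: "1 \<le> n" and k: "1 \<le> k" for n k
  proof -
    have half: "2 * exp (- R * (1 + real n)) \<le> P (1 + n) / 2"
    proof -
      have "exp (- R * (1 + real n)) = exp (real (1 + n) * - R)" by (simp add: algebra_simps)
      also have "\<dots> = (c / 4) ^ (1 + n)" unfolding eR[symmetric] by (rule exp_of_nat_mult)
      also have "\<dots> = c ^ (1 + n) / 4 ^ (1 + n)" by (rule power_divide)
      also have "\<dots> \<le> P (1 + n) / 4"
        using c(3)[of "1 + n"] c(1) P_pos[of "1 + n"] by (intro frac_le) auto
      finally show ?thesis by simp
    qed
    let ?x = "(P (1 + n))\<^sup>2 / (8 * R * (1 + real n)\<^sup>2)"
    have x: "0 < ?x" using P_pos[of "1 + n"] R by simp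
    have "?x = (P (1 + n) / 2)\<^sup>2 / (2 * R * (1 + real n)\<^sup>2)"
      by (simp add: power_divide)
    also have "\<dots> \<le> (P (1 + n) - 2 * exp (- R * (1 + real n)))\<^sup>2 / (2 * R * (1 + real n)\<^sup>2)"
      using half R P_pos[of "1 + n"] by (intro divide_right_mono power_mono) auto
    finally have "?x ^ k \<le> ((P (1 + n) - 2 * exp (- R * (1 + real n)))\<^sup>2 / (2 * R * (1 + real n)\<^sup>2)) ^ k"
      using x by (intro power_mono) auto
    also have "\<dots> \<le> P (1 + 2 * k * n)"
      using n k R half P_pos[of "1 + n"] by (intro keyP) auto
    finally have "ln (?x ^ k) \<le> ln (P (1 + 2 * k * n))"
      using x P_pos by (subst ln_le_cancel_iff) auto
    also have "ln (?x ^ k) = real k * ln ?x" by (rule ln_realpow)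
    also have "ln ?x = - 2 * (l (1 + n) + e (1 + real n))"
      using P_pos[of "1 + n"] R by (simp add: ln_div l_def e_def ln_realpow)
    finally have "l (1 + 2 * k * n) \<le> real k * (2 * (l (1 + n) + e (1 + real n)))"
      by (simp only: l_def[of "1 + 2 * k * n"])
    also have "\<dots> = (2 * real k * real n) * a n"
      using n by (simp add: a_def)
    finally show ?thesis .
  qed
  define L where "L = Inf (a ` {1..})"
  have bdd: "bdd_below (a ` {1..})" using a_nonneg by (intro bdd_belowI[of _ 0]) auto
  have L_le: "L \<le> a n" if "1 \<le> n" for n unfolding L_def using bdd that by (intro cInf_lower) auto
  have L_nonneg: "0 \<le> L" unfolding L_def using a_nonneg by (intro cInf_greatest) auto

  define f where "f t = - ln (p t)" for t
  have p_pos: "0 < p t" if "0 \<le> t" for t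
  proof -
    have "t \<le> \<delta> * real (nat \<lceil>t / \<delta>\<rceil>)" using \<delta> real_nat_ceiling_ge[of "t / \<delta>"]
      by (simp add: divide_le_eq mult.commute)
    from anti[OF that this] P_pos[of "nat \<lceil>t / \<delta>\<rceil>"] show ?thesis unfolding P_def by linarith
  qed
  have f_mono: "f s \<le> f t" if "0 \<le> s" "s \<le> t" for s t
    unfolding f_def using p_pos[of s] p_pos[of t] anti[OF that] that by simp
  have l_f: "l n = f (\<delta> * real n)" for n by (simp add: l_def f_def P_def)
  have upper: "f t \<le> (t / \<delta> + 2 * real n) * a n" if n: "1 \<le> n" and t: "0 < t" for n t
  proof -
    \<comment> \<open>With this k the time 1 + 2 k n, in units of \<open>\<delta>\<close>, lies beyond t, but by at most 1 + 2 n units.\<close>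
    define k where "k = nat \<lceil>t / (2 * real n * \<delta>)\<rceil>"
    have k1: "t / (2 * real n * \<delta>) \<le> real k" unfolding k_def by (rule real_nat_ceiling_ge)
    have "0 < t / (2 * real n * \<delta>)" using t \<delta> n by simp
    then have k: "1 \<le> k" and k2: "real k \<le> t / (2 * real n * \<delta>) + 1"
      unfolding k_def by linarith+
    have "t \<le> \<delta> * real (1 + 2 * k * n)"
      using k1 n \<delta> by (simp add: field_simps)
    then have "f t \<le> l (1 + 2 * k * n)" unfolding l_f using t by (intro f_mono) auto
    also have "\<dots> \<le> (2 * real k * real n) * a n" by (rule l_le[OF n k])
    also have "\<dots> \<le> (t / \<delta> + 2 * real n) * a n"
    proof (rule mult_right_mono[OF _ a_nonneg])
      have "2 * real n * real k \<le> 2 * real n * (t / (2 * real n * \<delta>) + 1)"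
        using k2 by (intro mult_left_mono) auto
      also have "\<dots> = t / \<delta> + 2 * real n" using n \<delta> by (simp add: field_simps)
      finally show "2 * real k * real n \<le> t / \<delta> + 2 * real n" by (simp add: mult_ac)
    qed
    finally show ?thesis .
  qed
  have lower: "(t / \<delta> - 2) * L - e (t / \<delta>) \<le> f t" if t: "2 * \<delta> \<le> t" for t
  proof -
    define m where "m = nat \<lfloor>t / \<delta>\<rfloor>"
    have td: "2 \<le> t / \<delta>" using t \<delta> by (simp add: field_simps)
    then have m: "2 \<le> m" "real m \<le> t / \<delta>" "t / \<delta> - 1 \<le> real m" unfolding m_def by linarith+
    have "e (real m) \<le> e (t / \<delta>)"
      unfolding e_def using R m by (intro divide_right_mono ln_mono mult_left_mono power_mono) auto
    moreover have "(t / \<delta> - 2) * L \<le> (real m - 1) * L"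
      using m L_nonneg by (intro mult_right_mono) auto
    moreover have "(real m - 1) * L \<le> (real m - 1) * a (m - 1)"
      using m by (intro mult_left_mono L_le) auto
    moreover have "(real m - 1) * a (m - 1) = l m + e (real m)"
      using m by (simp add: a_def of_nat_diff)
    moreover have "l m \<le> f t"
      unfolding l_f using m \<delta> by (intro f_mono) (auto simp: field_simps)
    ultimately show ?thesis by linarith
  qed
  have "((\<lambda>t. f t / t) \<longlongrightarrow> L / \<delta>) at_top"
  proof (rule order_tendstoI)
    fix b assume b: "b < L / \<delta>"
    have "((\<lambda>t. ((t / \<delta> - 2) * L - e (t / \<delta>)) / t) \<longlongrightarrow> L / \<delta>) at_top"
      unfolding e_def using \<delta> R(1) by real_asymp (simp add: field_simps)
    from order_tendstoD(1)[OF this b] eventually_ge_at_top[of "2 * \<delta>"]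
    show "eventually (\<lambda>t. b < f t / t) at_top"
    proof eventually_elim
      case (elim t)
      then have "((t / \<delta> - 2) * L - e (t / \<delta>)) / t \<le> f t / t"
        using \<delta> by (intro divide_right_mono lower) auto
      with elim show ?case by linarith
    qed
  next
    fix b assume b: "L / \<delta> < b"
    then have "L < b * \<delta>" using \<delta> by (simp add: field_simps)
    then obtain n where n: "1 \<le> n" "a n < b * \<delta>"
      unfolding L_def using cInf_lessD[of "a ` {1..}" "b * \<delta>"] by auto
    have "((\<lambda>t. ((t / \<delta> + 2 * real n) * a n) / t) \<longlongrightarrow> a n / \<delta>) at_top"
      using \<delta> by real_asymp (simp add: field_simps)
    moreover have "a n / \<delta> < b" using n \<delta> by (simp add: field_simps)
    ultimately have "eventually (\<lambda>t. ((t / \<delta> + 2 * real n) * a n) / t < b) at_top"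
      by (rule order_tendstoD(2))
    then show "eventually (\<lambda>t. f t / t < b) at_top"
      using eventually_gt_at_top[of 0]
    proof eventually_elim
      case (elim t)
      then have "f t / t \<le> ((t / \<delta> + 2 * real n) * a n) / t"
        using n by (intro divide_right_mono upper) auto
      with elim show ?case by linarith
    qed
  qed
  then have "((\<lambda>t. - (f t / t)) \<longlongrightarrow> - (L / \<delta>)) at_top" by (rule tendsto_minus)
  then have "((\<lambda>t. 1 / t * ln (p t)) \<longlongrightarrow> - (L / \<delta>)) at_top" by (simp add: f_def)
  then show ?thesis using L_nonneg \<delta> p_pos by (intro exI[of _ "L / \<delta>"]) auto
qed

context complex_brownian_motion
begin

text \<open>
  The inequality for killed walks with $hK = \delta$ and $hL = n\delta$ does not depend on the mesh \<open>h\<close>, so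
  the mesh can tend to 0 first; afterwards the closed sets grow to \<open>D\<close>. The radius
  $\rho = 2\sqrt{\delta R}\,(1+n)$ of the disc makes the Gaussian tail equal to $2e^{-R(1+n)}$.
\<close>

lemma survival_supermultiplicative:
  assumes D: "open D" "0 \<in> D" and \<delta>: "0 < \<delta>" and R: "0 < R" and k: "1 \<le> k"
  shows "((max 0 (prob (survive D (\<delta> * (1 + real n))) - 2 * exp (- R * (1 + real n))))\<^sup>2
      / (2 * R * (1 + real n)\<^sup>2)) ^ k \<le> prob (survive D (\<delta> * (1 + 2 * real k * real n)))"
proof -
  define g where "g x = ((max 0 (x - 2 * exp (- R * (1 + real n))))\<^sup>2 / (2 * R * (1 + real n)\<^sup>2)) ^ k" for x
  have g: "((\<lambda>m. g (f m)) \<longlongrightarrow> g x) F" if "(f \<longlongrightarrow> x) F" for f :: "nat \<Rightarrow> real" and x F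
    unfolding g_def using that R by (intro tendsto_intros) auto
  have grid: "g (prob (grid_stay A (\<delta> / 2 ^ m) ((1 + n) * 2 ^ m))) \<le> prob (grid_stay A (\<delta> / 2 ^ m) ((1 + 2 * k * n) * 2 ^ m))"
    if A: "closed A" "0 \<in> A" for A m
  proof -
    define \<rho> where "\<rho> = 2 * sqrt (\<delta> * R) * (1 + real n)"
    have \<rho>: "0 < \<rho>" using \<delta> R by (simp add: \<rho>_def)
    have \<rho>2: "\<rho>\<^sup>2 = 4 * \<delta> * R * (1 + real n)\<^sup>2" using \<delta> R by (simp add: \<rho>_def power_mult_distrib)
    have e1: "\<delta> / 2 ^ m * real (2 ^ m + n * 2 ^ m) = \<delta> * (1 + real n)" by (simp add: field_simps)
    have e2: "\<delta> / 2 ^ m * real (2 ^ m) = \<delta>" by simp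
    have e3: "- \<rho>\<^sup>2 / (4 * (\<delta> * (1 + real n))) = - R * (1 + real n)"
    proof -
      have "- (4 * \<delta> * R * x\<^sup>2) / (4 * (\<delta> * x)) = - R * x" if "0 < x" for x
        using that \<delta> by (simp add: power2_eq_square)
      then show ?thesis unfolding \<rho>2 by simp
    qed
    have e4: "\<rho>\<^sup>2 / (2 * \<delta>) = 2 * R * (1 + real n)\<^sup>2" unfolding \<rho>2 using \<delta> by simp
    have "((max 0 (prob (grid_stay A (\<delta> / 2 ^ m) (2 ^ m + n * 2 ^ m)) - 2 * exp (- \<rho>\<^sup>2 / (4 * (\<delta> / 2 ^ m * real (2 ^ m + n * 2 ^ m))))))\<^sup>2
      / (\<rho>\<^sup>2 / (2 * (\<delta> / 2 ^ m * real (2 ^ m))))) ^ k \<le> prob (grid_stay A (\<delta> / 2 ^ m) (2 ^ m + 2 * k * (n * 2 ^ m)))"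
      using \<delta> by (intro grid_stay_supermultiplicative[OF _ borel_closed[OF A(1)] A(2) \<rho> _ k]) auto
    then have "g (prob (grid_stay A (\<delta> / 2 ^ m) (2 ^ m + n * 2 ^ m))) \<le> prob (grid_stay A (\<delta> / 2 ^ m) (2 ^ m + 2 * k * (n * 2 ^ m)))"
      unfolding e1 e2 e3 e4 g_def .
    moreover have "2 ^ m + n * 2 ^ m = (1 + n) * 2 ^ m" "2 ^ m + 2 * k * (n * 2 ^ m) = (1 + 2 * k * n) * 2 ^ m"
      by (simp_all add: algebra_simps)
    ultimately show ?thesis by (simp only:)
  qed
  have closed_case: "g (prob (survive A (\<delta> * real (1 + n)))) \<le> prob (survive A (\<delta> * real (1 + 2 * k * n)))"
    if A: "closed A" "0 \<in> A" for A
  proof (rule LIMSEQ_le)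
    show "(\<lambda>m. g (prob (grid_stay A (\<delta> / 2 ^ m) ((1 + n) * 2 ^ m)))) \<longlonglongrightarrow> g (prob (survive A (\<delta> * real (1 + n))))"
      by (rule g, rule prob_grid_stay_tendsto[OF A(1)]) (use \<delta> in simp)
    show "(\<lambda>m. prob (grid_stay A (\<delta> / 2 ^ m) ((1 + 2 * k * n) * 2 ^ m))) \<longlonglongrightarrow> prob (survive A (\<delta> * real (1 + 2 * k * n)))"
      by (rule prob_grid_stay_tendsto[OF A(1)]) (use \<delta> in simp)
  qed (intro exI allI impI grid[OF A])
  obtain l0 where "{0} \<subseteq> inset D l0" using compact_subset_inset[OF D(1), of "{0}"] D(2) by auto
  then have l0: "0 \<in> inset D l" if "l0 \<le> l" for l using inset_mono[OF that] by blast
  have "g (prob (survive D (\<delta> * real (1 + n)))) \<le> prob (survive D (\<delta> * real (1 + 2 * k * n)))"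
  proof (rule LIMSEQ_le)
    show "(\<lambda>l. g (prob (survive (inset D l) (\<delta> * real (1 + n))))) \<longlonglongrightarrow> g (prob (survive D (\<delta> * real (1 + n))))"
      by (rule g, rule prob_survive_inset_tendsto[OF D(1)]) (use \<delta> in simp)
    show "(\<lambda>l. prob (survive (inset D l) (\<delta> * real (1 + 2 * k * n)))) \<longlonglongrightarrow> prob (survive D (\<delta> * real (1 + 2 * k * n)))"
      by (rule prob_survive_inset_tendsto[OF D(1)]) (use \<delta> in simp)
    show "\<exists>N. \<forall>l\<ge>N. g (prob (survive (inset D l) (\<delta> * real (1 + n)))) \<le> prob (survive (inset D l) (\<delta> * real (1 + 2 * k * n)))"
      by (intro exI[of _ l0] allI impI closed_case[OF closed_inset l0])
  qed
  then show ?thesis by (simp add: g_def mult.assoc)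
qed

lemma survival_rate_exists:
  assumes D: "open D" "0 \<in> D"
  shows "\<exists>L\<ge>0. ((\<lambda>t. 1 / t * ln (prob (survive D t))) \<longlongrightarrow> - L) at_top \<and> (\<forall>t\<ge>0. 0 < prob (survive D t))"
proof -
  obtain \<delta> where \<delta>: "0 < \<delta>" "0 < prob (survive D (2 * \<delta>))" using survive_initially[OF D] .
  show ?thesis
  proof (rule exponential_rate_exists[OF \<delta>(1)])
    show "prob (survive D t) \<le> prob (survive D s)" if "0 \<le> s" "s \<le> t" for s t
      by (rule finite_measure_mono[OF survive_anti[OF that(2)] survive_events[OF D(1) that(1)]])
    show "0 < prob (survive D (2 * \<delta>))" by (rule \<delta>(2))
    fix n k :: nat and R :: real
    assume a: "1 \<le> n" "1 \<le> k" "0 < R" "2 * exp (- R * (1 + real n)) \<le> prob (survive D (\<delta> * (1 + real n)))"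
    show "((prob (survive D (\<delta> * (1 + real n))) - 2 * exp (- R * (1 + real n)))\<^sup>2 / (2 * R * (1 + real n)\<^sup>2)) ^ k
        \<le> prob (survive D (\<delta> * (1 + 2 * real k * real n)))"
      using survival_supermultiplicative[OF D \<delta>(1) a(3) a(2), of n] a(4) by (simp add: max_absorb2)
  qed simp
qed

lemma rate_eqI:
  assumes "open D" "((\<lambda>t. 1 / t * ln (prob (survive D t))) \<longlongrightarrow> - L) at_top"
  shows "rate M W D = L"
proof -
  have "eventually (\<lambda>t. 1 / t * ln (prob {\<omega> \<in> space M. exit_time W D \<omega> > ennreal t}) = 1 / t * ln (prob (survive D t))) at_top"
    using eventually_ge_at_top[of 0]
  proof eventually_elim
    case (elim t) show ?case by (simp only: survive_eq_exit_time[OF assms(1) elim])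
  qed
  from iffD2[OF tendsto_cong[OF this] assms(2)]
  have "((\<lambda>t. 1 / t * ln (prob {\<omega> \<in> space M. exit_time W D \<omega> > ennreal t})) \<longlongrightarrow> - L) at_top" .
  from tendsto_Lim[OF _ this] show ?thesis by (simp add: rate_def)
qed

end

section \<open>Optional stopping and the strip of possible positions\<close>

context complex_brownian_motion
begin

lemma past_times_increment:
  fixes U :: "'a \<Rightarrow> real" and g :: "real \<Rightarrow> real"
  assumes st: "0 \<le> s" "s < t" and U: "U \<in> borel_measurable (past s)" "integrable M U"
    and g: "g \<in> borel_measurable borel" "integrable M (\<lambda>\<omega>. g (Re (W t \<omega> - W s \<omega>)))"
  shows "integrable M (\<lambda>\<omega>. U \<omega> * g (Re (W t \<omega> - W s \<omega>)))"
    and "expectation (\<lambda>\<omega>. U \<omega> * g (Re (W t \<omega> - W s \<omega>))) = expectation U * expectation (\<lambda>\<omega>. g (Re (W t \<omega> - W s \<omega>)))"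
proof -
  have "indep_var borel ((\<lambda>x. x) \<circ> U) borel (g \<circ> (\<lambda>\<omega>. Re (W t \<omega> - W s \<omega>)))"
    by (rule indep_var_compose[OF indep_var_past_Re_increment[OF st U(1)] _ g(1)]) simp
  then have ind: "indep_var borel U borel (\<lambda>\<omega>. g (Re (W t \<omega> - W s \<omega>)))" by (simp add: comp_def)
  show "integrable M (\<lambda>\<omega>. U \<omega> * g (Re (W t \<omega> - W s \<omega>)))"
    by (rule indep_var_integrable[OF ind U(2) g(2)])
  show "expectation (\<lambda>\<omega>. U \<omega> * g (Re (W t \<omega> - W s \<omega>))) = expectation U * expectation (\<lambda>\<omega>. g (Re (W t \<omega> - W s \<omega>)))"
    by (rule indep_var_lebesgue_integral[OF ind U(2) g(2)])
qed

lemma Re_increment_gauss: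
  "0 \<le> s \<Longrightarrow> s < t \<Longrightarrow> distributed M lborel (\<lambda>\<omega>. Re (W t \<omega> - W s \<omega>)) (normal_density 0 (sqrt (t - s)))"
  by (rule distributed_Re_gauss[OF increment_gauss]) auto

lemma integrable_Re_W:
  assumes "0 \<le> s"
  shows "integrable M (\<lambda>\<omega>. Re (W s \<omega>))" "integrable M (\<lambda>\<omega>. (Re (W s \<omega>))\<^sup>2)"
proof -
  have Wm[measurable]: "W s \<in> borel_measurable M" using assms by (rule measurable_W)
  have "integrable M (\<lambda>\<omega>. Re (W s \<omega>)) \<and> integrable M (\<lambda>\<omega>. (Re (W s \<omega>))\<^sup>2)"
  proof (cases "s = 0")
    case True
    have "integrable M (\<lambda>\<omega>. Re (W s \<omega>)) \<longleftrightarrow> integrable M (\<lambda>\<omega>. 0 :: real)"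
      by (rule integrable_cong_AE) (use start_at_0 True Wm in auto)
    moreover have "integrable M (\<lambda>\<omega>. (Re (W s \<omega>))\<^sup>2) \<longleftrightarrow> integrable M (\<lambda>\<omega>. 0 :: real)"
      by (rule integrable_cong_AE) (use start_at_0 True Wm in auto)
    ultimately show ?thesis by simp
  next
    case False
    then have s: "0 < s" using assms by simp
    note d = distributed_Re_gauss[OF W_gauss[OF s] s]
    show ?thesis using gaussian_moments(1)[OF d s] gaussian_moments(3)[OF d s] by simp
  qed
  then show "integrable M (\<lambda>\<omega>. Re (W s \<omega>))" "integrable M (\<lambda>\<omega>. (Re (W s \<omega>))\<^sup>2)" by auto
qed

lemma integrable_indicator_times:
  fixes f :: "'a \<Rightarrow> real"
  assumes "E \<in> events" "integrable M f"
  shows "integrable M (\<lambda>\<omega>. indicator E \<omega> * f \<omega>)"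
  using integrable_mult_indicator[OF assms] by simp

lemma integrable_indicator_event: "E \<in> events \<Longrightarrow> integrable M (indicator E :: 'a \<Rightarrow> real)"
  by (rule integrable_real_indicator) (simp_all add: emeasure_eq_measure)

text \<open>
  The real part (times a sign \<open>c\<close>) at the times $t, t+h, t+2h, \dots$, frozen at the first of them at which the
  domain has already been left, and after at most \<open>n\<close> steps.
\<close>

primrec stopped_walk :: "real \<Rightarrow> complex set \<Rightarrow> real \<Rightarrow> real \<Rightarrow> nat \<Rightarrow> 'a \<Rightarrow> real" where
  "stopped_walk c D t h 0 \<omega> = c * Re (W t \<omega>)"
| "stopped_walk c D t h (Suc n) \<omega> = stopped_walk c D t h n \<omega> +
     indicator (survive D (t + h * real n)) \<omega> * (c * Re (W (t + h * real (Suc n)) \<omega> - W (t + h * real n) \<omega>))"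

lemma stopped_walk_position:
  assumes h: "0 \<le> h"
  shows "\<exists>k\<le>n. stopped_walk c D t h n \<omega> = c * Re (W (t + h * real k) \<omega>)
    \<and> (\<Sum>j<n. indicator (survive D (t + h * real j)) \<omega>) = real k
    \<and> (\<forall>j<k. \<omega> \<in> survive D (t + h * real j))
    \<and> (k = n \<or> \<omega> \<notin> survive D (t + h * real k))"
proof (induction n)
  case 0 then show ?case by simp
next
  case (Suc n)
  then obtain k where k: "k \<le> n" "stopped_walk c D t h n \<omega> = c * Re (W (t + h * real k) \<omega>)"
    "(\<Sum>j<n. indicator (survive D (t + h * real j)) \<omega>) = real k"
    "\<And>j. j < k \<Longrightarrow> \<omega> \<in> survive D (t + h * real j)"
    "k = n \<or> \<omega> \<notin> survive D (t + h * real k)" by blast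
  show ?case
  proof (cases "\<omega> \<in> survive D (t + h * real n)")
    case True
    have "t + h * real k \<le> t + h * real n" using k(1) h by (simp add: mult_left_mono)
    then have "k = n" using k(5) True survive_anti by blast
    have "stopped_walk c D t h (Suc n) \<omega> = c * Re (W (t + h * real (Suc n)) \<omega>)"
      using True k(2) \<open>k = n\<close> by (simp add: algebra_simps)
    moreover have "(\<Sum>j<Suc n. indicator (survive D (t + h * real j)) \<omega>) = real (Suc n)"
      using True k(3) \<open>k = n\<close> by simp
    moreover have "\<forall>j<Suc n. \<omega> \<in> survive D (t + h * real j)"
      using True k(4) \<open>k = n\<close> less_Suc_eq by auto
    ultimately show ?thesis by blast
  next
    case False
    then have "k = n \<longrightarrow> \<omega> \<notin> survive D (t + h * real k)" by blast
    then have "\<omega> \<notin> survive D (t + h * real k)" using k(5) by blast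
    moreover have "stopped_walk c D t h (Suc n) \<omega> = c * Re (W (t + h * real k) \<omega>)"
      using False k(2) by simp
    moreover have "(\<Sum>j<Suc n. indicator (survive D (t + h * real j)) \<omega>) = real k"
      using False k(3) by simp
    ultimately show ?thesis using k(1,4) by (intro exI[of _ k]) auto
  qed
qed

lemma stopped_walk_on_survive:
  assumes "0 \<le> h" "\<omega> \<in> survive D (t + h * real n)"
  shows "stopped_walk c D t h n \<omega> = c * Re (W (t + h * real n) \<omega>)"
proof -
  obtain k where k: "k \<le> n" "stopped_walk c D t h n \<omega> = c * Re (W (t + h * real k) \<omega>)"
    "k = n \<or> \<omega> \<notin> survive D (t + h * real k)"
    using stopped_walk_position[OF assms(1), of n c D t \<omega>] by blast
  have "t + h * real k \<le> t + h * real n" using k(1) assms by (simp add: mult_left_mono)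
  then have "\<omega> \<in> survive D (t + h * real k)" using survive_anti assms(2) by blast
  then have "k = n" using k(3) by blast
  with k(2) show ?thesis by simp
qed

text \<open>
  Each step adds an increment independent of the past, multiplied by a function of the past. Hence the mean
  over a past event does not change, and the second moment grows by \<open>h\<close> times the probability that the step
  is made.
\<close>

lemma stopped_walk_moments:
  assumes D: "open D" and t: "0 \<le> t" and h: "0 < h" and E: "E \<in> sets (past t)" and c: "c\<^sup>2 = 1"
  defines "Y \<equiv> stopped_walk c D t h"
  shows "integrable M (\<lambda>\<omega>. indicator E \<omega> * (Y n \<omega> - b))
    \<and> expectation (\<lambda>\<omega>. indicator E \<omega> * (Y n \<omega> - b)) = expectation (\<lambda>\<omega>. indicator E \<omega> * (c * Re (W t \<omega>) - b))
    \<and> integrable M (\<lambda>\<omega>. indicator E \<omega> * (Y n \<omega> - b)\<^sup>2)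
    \<and> expectation (\<lambda>\<omega>. indicator E \<omega> * (Y n \<omega> - b)\<^sup>2)
      = expectation (\<lambda>\<omega>. indicator E \<omega> * (c * Re (W t \<omega>) - b)\<^sup>2) + h * (\<Sum>j<n. prob (E \<inter> survive D (t + h * real j)))"
proof (induction n)
  case 0
  have Ee: "E \<in> events" using E past_subset_events by blast
  have "(c * Re (W t \<omega>) - b)\<^sup>2 = (Re (W t \<omega>))\<^sup>2 - 2 * b * c * Re (W t \<omega>) + b\<^sup>2" for \<omega>
    using c by (simp add: power2_diff power_mult_distrib)
  then have "integrable M (\<lambda>\<omega>. (c * Re (W t \<omega>) - b)\<^sup>2)"
    using integrable_Re_W[OF t] by simp
  moreover have "integrable M (\<lambda>\<omega>. c * Re (W t \<omega>) - b)"
    using integrable_Re_W[OF t] by simp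
  ultimately show ?case
    using integrable_indicator_times[OF Ee] by (simp add: Y_def)
next
  case (Suc n)
  let ?s = "t + h * real n" and ?s' = "t + h * real (Suc n)"
  let ?\<zeta> = "\<lambda>\<omega>. Re (W ?s' \<omega> - W ?s \<omega>)"
  have s: "0 \<le> ?s" "?s < ?s'" "t \<le> ?s" "?s' - ?s = h" using t h by (auto simp: algebra_simps)
  have sh: "0 < ?s' - ?s" using s h by simp
  define G where "G = E \<inter> survive D ?s"
  have G: "G \<in> sets (past ?s)"
    unfolding G_def using past_mono[OF s(3)] E survive_past[OF D s(1)] by blast
  have Ge: "G \<in> events" using G past_subset_events by blast
  note moments = gaussian_moments[OF Re_increment_gauss[OF s(1,2)] sh, unfolded s(4)]
  have Wp: "(\<lambda>\<omega>. Re (W ?s \<omega>)) \<in> borel_measurable (past ?s)"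
    using W_measurable_past[OF s(1) order_refl] by measurable
  have Gp: "(indicator G :: 'a \<Rightarrow> real) \<in> borel_measurable (past ?s)"
    using G by (rule borel_measurable_indicator)
  define U1 where "U1 \<omega> = c * indicator G \<omega>" for \<omega>
  define U2 where "U2 \<omega> = 2 * c * (indicator G \<omega> * (c * Re (W ?s \<omega>) - b))" for \<omega>
  define U3 where "U3 \<omega> = (indicator G \<omega> :: real)" for \<omega>
  have U1: "U1 \<in> borel_measurable (past ?s)" "integrable M U1"
    unfolding U1_def using Gp integrable_indicator_event[OF Ge] by auto
  have U2: "U2 \<in> borel_measurable (past ?s)"
    unfolding U2_def using Gp Wp by measurable
  have U2i: "integrable M U2"
    unfolding U2_def using integrable_Re_W[OF s(1)]
    by (intro integrable_mult_right integrable_indicator_times[OF Ge]) simp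
  have U3: "U3 \<in> borel_measurable (past ?s)" "integrable M U3"
    unfolding U3_def using Gp integrable_indicator_event[OF Ge] by auto
  have 1: "integrable M (\<lambda>\<omega>. U1 \<omega> * ?\<zeta> \<omega>)" "expectation (\<lambda>\<omega>. U1 \<omega> * ?\<zeta> \<omega>) = 0"
    using past_times_increment[OF s(1,2) U1, of "\<lambda>x. x"] moments(1,2) by auto
  have 2: "integrable M (\<lambda>\<omega>. U2 \<omega> * ?\<zeta> \<omega>)" "expectation (\<lambda>\<omega>. U2 \<omega> * ?\<zeta> \<omega>) = 0"
    using past_times_increment[OF s(1,2) U2 U2i, of "\<lambda>x. x"] moments(1,2) by auto
  have "expectation U3 = prob G" unfolding U3_def using Ge by simp
  then have 3: "integrable M (\<lambda>\<omega>. U3 \<omega> * (?\<zeta> \<omega>)\<^sup>2)" "expectation (\<lambda>\<omega>. U3 \<omega> * (?\<zeta> \<omega>)\<^sup>2) = h * prob G"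
    using past_times_increment[OF s(1,2) U3, of "\<lambda>x. x\<^sup>2"] moments(3,4) by auto
  have lin: "indicator E \<omega> * (Y (Suc n) \<omega> - b) = indicator E \<omega> * (Y n \<omega> - b) + U1 \<omega> * ?\<zeta> \<omega>" for \<omega>
    unfolding Y_def U1_def G_def
    by (simp del: of_nat_Suc add: indicator_inter_arith algebra_simps)
  have quad: "indicator E \<omega> * (Y (Suc n) \<omega> - b)\<^sup>2 = indicator E \<omega> * (Y n \<omega> - b)\<^sup>2 + U2 \<omega> * ?\<zeta> \<omega> + U3 \<omega> * (?\<zeta> \<omega>)\<^sup>2" for \<omega>
  proof (cases "\<omega> \<in> G")
    case True
    then have \<omega>: "\<omega> \<in> E" "\<omega> \<in> survive D ?s" by (auto simp: G_def)
    have Y: "Y (Suc n) \<omega> = Y n \<omega> + c * ?\<zeta> \<omega>" using \<omega> by (simp add: Y_def)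
    have Y': "Y n \<omega> = c * Re (W ?s \<omega>)"
      unfolding Y_def using stopped_walk_on_survive[OF less_imp_le[OF h] \<omega>(2)] .
    have "(Y (Suc n) \<omega> - b)\<^sup>2 = (Y n \<omega> - b)\<^sup>2 + 2 * c * (Y n \<omega> - b) * ?\<zeta> \<omega> + c\<^sup>2 * (?\<zeta> \<omega>)\<^sup>2"
      unfolding Y by (simp add: power2_eq_square algebra_simps)
    then show ?thesis using True \<omega> by (simp add: c U2_def U3_def Y')
  next
    case False
    then have "indicator E \<omega> * (Y (Suc n) \<omega> - b)\<^sup>2 = indicator E \<omega> * (Y n \<omega> - b)\<^sup>2"
      by (auto simp: G_def Y_def indicator_def)
    with False show ?thesis by (simp add: U2_def U3_def)
  qed
  define A where "A \<omega> = indicator E \<omega> * (Y n \<omega> - b)" for \<omega>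
  define B where "B \<omega> = indicator E \<omega> * (Y n \<omega> - b)\<^sup>2" for \<omega>
  have A: "integrable M A" "expectation A = expectation (\<lambda>\<omega>. indicator E \<omega> * (c * Re (W t \<omega>) - b))"
    and B: "integrable M B" "expectation B = expectation (\<lambda>\<omega>. indicator E \<omega> * (c * Re (W t \<omega>) - b)\<^sup>2)
       + h * (\<Sum>j<n. prob (E \<inter> survive D (t + h * real j)))"
    using Suc.IH unfolding A_def[abs_def] B_def[abs_def] by blast+
  have "expectation (\<lambda>\<omega>. A \<omega> + U1 \<omega> * ?\<zeta> \<omega>) = expectation A"
    using 1(2) by (subst Bochner_Integration.integral_add[OF A(1) 1(1)]) simp
  moreover have "expectation (\<lambda>\<omega>. B \<omega> + U2 \<omega> * ?\<zeta> \<omega> + U3 \<omega> * (?\<zeta> \<omega>)\<^sup>2) = expectation B + h * prob G"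
    using 2(2) 3(2)
    by (simp only: Bochner_Integration.integral_add[OF Bochner_Integration.integrable_add[OF B(1) 2(1)] 3(1)]
        Bochner_Integration.integral_add[OF B(1) 2(1)])
  moreover have "integrable M (\<lambda>\<omega>. A \<omega> + U1 \<omega> * ?\<zeta> \<omega>)"
    by (rule Bochner_Integration.integrable_add[OF A(1) 1(1)])
  moreover have "integrable M (\<lambda>\<omega>. B \<omega> + U2 \<omega> * ?\<zeta> \<omega> + U3 \<omega> * (?\<zeta> \<omega>)\<^sup>2)"
    by (rule Bochner_Integration.integrable_add[OF Bochner_Integration.integrable_add[OF B(1) 2(1)] 3(1)])
  moreover have "h * (\<Sum>j<Suc n. prob (E \<inter> survive D (t + h * real j)))
      = h * (\<Sum>j<n. prob (E \<inter> survive D (t + h * real j))) + h * prob G"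
    by (simp add: G_def distrib_left)
  ultimately show ?case
    unfolding lin quad A_def[symmetric] B_def[symmetric] using A(2) B(2) by simp
qed

lemma exit_time_measurable:
  assumes "open D"
  shows "exit_time W D \<in> borel_measurable M"
proof (rule borel_measurableI_greater)
  fix y :: ennreal
  show "{\<omega> \<in> space M. y < exit_time W D \<omega>} \<in> events"
  proof (cases y)
    case (real t)
    then show ?thesis using survive_events[OF assms, of t] survive_eq_exit_time[OF assms, of t] by simp
  next
    case top
    then show ?thesis by simp
  qed
qed

text \<open>
  The number of grid times before the exit, times the mesh, exceeds the exit time by at most one mesh. This
  bounds the second moments of the stopped walk uniformly.
\<close>

lemma sum_survival_le:
  assumes D: "open D" and t: "0 \<le> t" and h: "0 < h" and fin: "(\<integral>\<^sup>+\<omega>. exit_time W D \<omega> \<partial>M) < \<infinity>"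
  shows "h * (\<Sum>j<n. prob (survive D (t + h * real j))) \<le> expectation (\<lambda>\<omega>. enn2real (exit_time W D \<omega>)) + h"
proof -
  have \<tau>m[measurable]: "exit_time W D \<in> borel_measurable M" by (rule exit_time_measurable[OF D])
  have \<tau>fin: "AE \<omega> in M. exit_time W D \<omega> \<noteq> \<infinity>"
    using fin by (intro nn_integral_PInf_AE) auto
  have int: "integrable M (\<lambda>\<omega>. enn2real (exit_time W D \<omega>))"
  proof (rule integrableI_nonneg)
    have "(\<integral>\<^sup>+\<omega>. ennreal (enn2real (exit_time W D \<omega>)) \<partial>M) \<le> (\<integral>\<^sup>+\<omega>. exit_time W D \<omega> \<partial>M)"
      by (intro nn_integral_mono) (simp add: ennreal_enn2real_if)
    then show "(\<integral>\<^sup>+\<omega>. ennreal (enn2real (exit_time W D \<omega>)) \<partial>M) < \<infinity>" using fin by (rule le_less_trans)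
  qed auto
  have ev: "survive D (t + h * real j) \<in> events" for j using t h by (intro survive_events D) simp
  have inti: "integrable M (\<lambda>\<omega>. h * (\<Sum>j<n. indicator (survive D (t + h * real j)) \<omega>))"
    using integrable_indicator_event[OF ev]
    by (intro integrable_mult_right Bochner_Integration.integrable_sum) auto
  have "h * (\<Sum>j<n. prob (survive D (t + h * real j))) = expectation (\<lambda>\<omega>. h * (\<Sum>j<n. indicator (survive D (t + h * real j)) \<omega>))"
    using integrable_indicator_event[OF ev] ev by (simp add: Bochner_Integration.integral_sum)
  also have "\<dots> \<le> expectation (\<lambda>\<omega>. enn2real (exit_time W D \<omega>) + h)"
  proof (rule integral_mono_AE[OF inti])
    show "integrable M (\<lambda>\<omega>. enn2real (exit_time W D \<omega>) + h)" using int by simp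
    show "AE \<omega> in M. h * (\<Sum>j<n. indicator (survive D (t + h * real j)) \<omega>) \<le> enn2real (exit_time W D \<omega>) + h"
      using \<tau>fin AE_space
    proof eventually_elim
      case (elim \<omega>)
      obtain k where k: "(\<Sum>j<n. indicator (survive D (t + h * real j)) \<omega>) = real k"
        "\<And>j. j < k \<Longrightarrow> \<omega> \<in> survive D (t + h * real j)"
        using stopped_walk_position[OF less_imp_le[OF h], of n 1 D t \<omega>] by blast
      show ?case
      proof (cases k)
        case 0 then show ?thesis using k(1) h by simp
      next
        case (Suc i)
        then have "\<omega> \<in> survive D (t + h * real i)" using k(2) by simp
        then have "ennreal (t + h * real i) < exit_time W D \<omega>"
          using exit_time_gt_iff[OF D elim(2), of "t + h * real i"] t h by (simp add: survive_def)
        then have "t + h * real i < enn2real (exit_time W D \<omega>)"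
          using elim(1) t h by (cases "exit_time W D \<omega>") (auto simp: ennreal_less_iff simp del: ennreal_plus)
        then show ?thesis unfolding k(1) Suc using t by (simp add: algebra_simps)
      qed
    qed
  qed
  also have "\<dots> = expectation (\<lambda>\<omega>. enn2real (exit_time W D \<omega>)) + h"
    using int by (simp add: prob_space)
  finally show ?thesis .
qed

text \<open>
  The walk stops at the exit time rounded up to the grid, as soon as the horizon $t + 2^n$ lies beyond the
  exit time.
\<close>

lemma stopped_walk_tendsto:
  assumes D: "open D" and t: "0 \<le> t" and \<omega>: "\<omega> \<in> survive D t" and fin: "exit_time W D \<omega> \<noteq> \<infinity>"
  shows "(\<lambda>n. stopped_walk c D t (1 / 2 ^ n) (4 ^ n) \<omega>) \<longlonglongrightarrow> c * Re (W (enn2real (exit_time W D \<omega>)) \<omega>)"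
proof -
  have sp: "\<omega> \<in> space M" using \<omega> by (simp add: survive_def)
  define T where "T = enn2real (exit_time W D \<omega>)"
  have T: "exit_time W D \<omega> = ennreal T" "0 \<le> T"
    using fin by (auto simp: T_def ennreal_enn2real_if)
  have surv: "\<omega> \<in> survive D s \<longleftrightarrow> s < T" if "0 \<le> s" for s
    using exit_time_gt_iff[OF D sp that] sp that by (simp add: survive_def T(1) ennreal_less_iff)
  have tT: "t < T" using surv[OF t] \<omega> by simp
  have "\<exists>k. \<forall>n. stopped_walk c D t (1 / 2 ^ n) (4 ^ n) \<omega> = c * Re (W (t + 1 / 2 ^ n * real (k n)) \<omega>)
     \<and> (T < 2 ^ n - 1 \<longrightarrow> T \<le> t + 1 / 2 ^ n * real (k n) \<and> t + 1 / 2 ^ n * real (k n) \<le> T + 1 / 2 ^ n)"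
  proof (rule choice, rule allI)
    fix n :: nat
    let ?h = "1 / 2 ^ n :: real"
    obtain k where k: "stopped_walk c D t ?h (4 ^ n) \<omega> = c * Re (W (t + ?h * real k) \<omega>)"
      "\<And>j. j < k \<Longrightarrow> \<omega> \<in> survive D (t + ?h * real j)"
      "k = 4 ^ n \<or> \<omega> \<notin> survive D (t + ?h * real k)"
      using stopped_walk_position[of ?h "4 ^ n" c D t \<omega>] by auto
    have nn: "0 \<le> t + ?h * real j" for j using t by simp
    have k0: "k \<noteq> 0"
    proof
      assume "k = 0" then show False using k(3) \<omega> by simp
    qed
    then obtain i where i: "k = Suc i" by (cases k) auto
    have "t + ?h * real i < T" using k(2)[of i] surv[OF nn] i by simp
    then have le: "t + ?h * real k \<le> T + ?h" unfolding i by (simp add: algebra_simps add_divide_distrib)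
    have "T \<le> t + ?h * real k" if "T < 2 ^ n - 1"
    proof (rule ccontr)
      assume "\<not> T \<le> t + ?h * real k"
      then have "\<omega> \<in> survive D (t + ?h * real k)" using surv[OF nn] by simp
      then have "k = 4 ^ n" using k(3) by blast
      have "(4::real) ^ n = 2 ^ n * 2 ^ n" by (simp flip: power_mult_distrib)
      then have "?h * real k = 2 ^ n" unfolding \<open>k = 4 ^ n\<close> by simp
      then have "t + 2 ^ n \<le> T + ?h" using le by simp
      moreover have "?h \<le> 1" by simp
      ultimately show False using that t by linarith
    qed
    with k(1) le show "\<exists>k. stopped_walk c D t ?h (4 ^ n) \<omega> = c * Re (W (t + ?h * real k) \<omega>)
     \<and> (T < 2 ^ n - 1 \<longrightarrow> T \<le> t + ?h * real k \<and> t + ?h * real k \<le> T + ?h)" by blast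
  qed
  then obtain k where k: "\<And>n. stopped_walk c D t (1 / 2 ^ n) (4 ^ n) \<omega> = c * Re (W (t + 1 / 2 ^ n * real (k n)) \<omega>)"
    "\<And>n. T < 2 ^ n - 1 \<Longrightarrow> T \<le> t + 1 / 2 ^ n * real (k n)"
    "\<And>n. T < 2 ^ n - 1 \<Longrightarrow> t + 1 / 2 ^ n * real (k n) \<le> T + 1 / 2 ^ n"
    by blast
  have big: "eventually (\<lambda>n. T < 2 ^ n - 1) sequentially"
  proof -
    obtain N where N: "T + 1 < 2 ^ N" using real_arch_pow[of 2 "T + 1"] by auto
    have "T < 2 ^ n - 1" if "N \<le> n" for n
      using N power_increasing[OF that, of "2::real"] by linarith
    then show ?thesis by (rule eventually_sequentiallyI)
  qed
  have "(\<lambda>n. (1 / 2) ^ n :: real) \<longlonglongrightarrow> 0" by (rule LIMSEQ_power_zero) simp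
  from tendsto_add[OF tendsto_const[of T] this]
  have h0: "(\<lambda>n. T + 1 / 2 ^ n) \<longlonglongrightarrow> T" by (simp add: power_divide)
  have lim: "(\<lambda>n. t + 1 / 2 ^ n * real (k n)) \<longlonglongrightarrow> T"
    by (rule tendsto_sandwich[OF _ _ tendsto_const[of T] h0]; rule eventually_mono[OF big]) (use k in auto)
  have "(\<lambda>n. W (t + 1 / 2 ^ n * real (k n)) \<omega>) \<longlonglongrightarrow> W T \<omega>"
    by (rule continuous_on_tendsto_compose[OF continuous_paths[OF sp] lim]) (use T t in auto)
  then show ?thesis unfolding k(1) T_def[symmetric] by (intro tendsto_intros)
qed

text \<open>
  Let \<open>E\<close> be the event that the path survives to time \<open>t\<close> and exceeds the bound there. The mean excess over
  \<open>E\<close> is the same for all stopped walks, and these converge to the exit position, where there is no excess.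
  Their second moments are bounded, so they are uniformly integrable: the excess truncated at \<open>K\<close> has vanishing
  mean, and the part above \<open>K\<close> contributes at most \<open>C / K\<close>. So the mean excess is 0 and \<open>E\<close> is null.
\<close>

lemma exit_bound_propagates:
  assumes D: "open D" and fin: "(\<integral>\<^sup>+\<omega>. exit_time W D \<omega> \<partial>M) < \<infinity>" and c: "c\<^sup>2 = 1" and t: "0 \<le> t"
    and bound: "AE \<omega> in M. c * Re (W (enn2real (exit_time W D \<omega>)) \<omega>) \<le> b"
  shows "AE \<omega> in M. \<omega> \<in> survive D t \<longrightarrow> c * Re (W t \<omega>) \<le> b"
proof -
  have \<tau>fin: "AE \<omega> in M. exit_time W D \<omega> \<noteq> \<infinity>"
    using fin exit_time_measurable[OF D] by (intro nn_integral_PInf_AE) auto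
  have Wp: "(\<lambda>\<omega>. c * Re (W t \<omega>)) \<in> borel_measurable (past t)"
    using W_measurable_past[OF t order_refl] by measurable
  define E where "E = survive D t \<inter> {\<omega> \<in> space (past t). b < c * Re (W t \<omega>)}"
  have E: "E \<in> sets (past t)"
  proof -
    have "E = survive D t \<inter> ((\<lambda>\<omega>. c * Re (W t \<omega>)) -` {b<..} \<inter> space (past t))" by (auto simp: E_def)
    then show ?thesis using survive_past[OF D t] measurable_sets[OF Wp, of "{b<..}"] by simp
  qed
  have Ee: "E \<in> events" using E past_subset_events by blast
  define Y where "Y n = stopped_walk c D t (1 / 2 ^ n) (4 ^ n)" for n :: nat
  define m where "m = expectation (\<lambda>\<omega>. indicator E \<omega> * (c * Re (W t \<omega>) - b))"
  define C where "C = expectation (\<lambda>\<omega>. indicator E \<omega> * (c * Re (W t \<omega>) - b)\<^sup>2)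
     + expectation (\<lambda>\<omega>. enn2real (exit_time W D \<omega>)) + 1"
  have hpos: "0 < 1 / (2::real) ^ n" for n by simp
  note mom = stopped_walk_moments[OF D t hpos E c, of _ _ b]
  have Y1: "integrable M (\<lambda>\<omega>. indicator E \<omega> * (Y n \<omega> - b))"
      "expectation (\<lambda>\<omega>. indicator E \<omega> * (Y n \<omega> - b)) = m"
    and Y2: "integrable M (\<lambda>\<omega>. indicator E \<omega> * (Y n \<omega> - b)\<^sup>2)" for n
    using mom[of n "4 ^ n"] by (auto simp: Y_def m_def)
  have Y3: "expectation (\<lambda>\<omega>. indicator E \<omega> * (Y n \<omega> - b)\<^sup>2) \<le> C" for n
  proof -
    let ?h = "1 / (2::real) ^ n"
    have "?h * (\<Sum>j<4 ^ n. prob (E \<inter> survive D (t + ?h * real j))) \<le> ?h * (\<Sum>j<4 ^ n. prob (survive D (t + ?h * real j)))"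
      using t by (intro mult_left_mono sum_mono finite_measure_mono survive_events[OF D]) auto
    also have "\<dots> \<le> expectation (\<lambda>\<omega>. enn2real (exit_time W D \<omega>)) + ?h"
      by (rule sum_survival_le[OF D t hpos fin])
    also have "\<dots> \<le> expectation (\<lambda>\<omega>. enn2real (exit_time W D \<omega>)) + 1" by simp
    finally show ?thesis using mom[of n "4 ^ n"] by (simp add: Y_def C_def)
  qed
  have "m \<le> C / K" if K: "0 < K" for K
  proof -
    define f where "f n \<omega> = indicator E \<omega> * min (max 0 (Y n \<omega> - b)) K" for n \<omega>
    have fm: "f n \<in> borel_measurable M" for n
    proof -
      have "f n = (\<lambda>\<omega>. min (max 0 (indicator E \<omega> * (Y n \<omega> - b))) K)"
        using K by (auto simp: f_def indicator_def fun_eq_iff)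
      then show ?thesis using borel_measurable_integrable[OF Y1(1)[of n]] by simp
    qed
    have fb: "\<bar>f n \<omega>\<bar> \<le> K" for n \<omega> using K by (auto simp: f_def indicator_def)
    have "(\<lambda>n. expectation (f n)) \<longlonglongrightarrow> expectation (\<lambda>\<omega>. 0 :: real)"
    proof (rule integral_dominated_convergence[where w="\<lambda>_. K"])
      show "AE \<omega> in M. (\<lambda>n. f n \<omega>) \<longlonglongrightarrow> 0"
        using \<tau>fin bound
      proof eventually_elim
        case (elim \<omega>)
        show ?case
        proof (cases "\<omega> \<in> E")
          case True
          let ?X = "c * Re (W (enn2real (exit_time W D \<omega>)) \<omega>)"
          have "(\<lambda>n. Y n \<omega>) \<longlonglongrightarrow> ?X"
            unfolding Y_def using True elim by (intro stopped_walk_tendsto[OF D t]) (auto simp: E_def)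
          then have "(\<lambda>n. min (max 0 (Y n \<omega> - b)) K) \<longlonglongrightarrow> min (max 0 (?X - b)) K"
            by (intro tendsto_min tendsto_max tendsto_diff tendsto_const)
          moreover have "min (max 0 (?X - b)) K = 0" using elim(2) K by simp
          ultimately show ?thesis using True by (simp add: f_def)
        qed (simp add: f_def)
      qed
    qed (use fm fb in auto)
    then have lim: "(\<lambda>n. expectation (f n) + C / K) \<longlonglongrightarrow> 0 + C / K"
      by (intro tendsto_add tendsto_const) simp
    have "m \<le> expectation (f n) + C / K" for n
    proof -
      have fi: "integrable M (f n)" using fm fb by (intro integrable_const_bound[of _ K]) auto
      \<comment> \<open>A value y above K is at most y^2 / K.\<close>
      have pt: "indicator E \<omega> * (Y n \<omega> - b) \<le> f n \<omega> + indicator E \<omega> * (Y n \<omega> - b)\<^sup>2 / K" for \<omega>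
      proof (cases "\<omega> \<in> E")
        case True
        let ?y = "Y n \<omega> - b"
        have "?y \<le> min (max 0 ?y) K + ?y\<^sup>2 / K"
        proof (cases "?y \<le> K")
          case True
          then have "?y \<le> min (max 0 ?y) K" by simp
          moreover have "0 \<le> ?y\<^sup>2 / K" using K by simp
          ultimately show ?thesis by linarith
        next
          case False
          then have "?y * K \<le> ?y * ?y" using K by (intro mult_left_mono) auto
          then have "?y \<le> ?y\<^sup>2 / K" using K by (simp add: pos_le_divide_eq power2_eq_square)
          moreover have "0 \<le> min (max 0 ?y) K" using K by simp
          ultimately show ?thesis by linarith
        qed
        with True show ?thesis by (simp add: f_def)
      qed (simp add: f_def)
      have "m \<le> expectation (\<lambda>\<omega>. f n \<omega> + indicator E \<omega> * (Y n \<omega> - b)\<^sup>2 / K)"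
        unfolding Y1(2)[of n, symmetric] using fi Y1(1)[of n] Y2[of n] pt by (intro integral_mono) auto
      also have "\<dots> = expectation (f n) + expectation (\<lambda>\<omega>. indicator E \<omega> * (Y n \<omega> - b)\<^sup>2) / K"
        using fi Y2[of n] by simp
      also have "\<dots> \<le> expectation (f n) + C / K"
        using Y3[of n] K by (simp add: divide_right_mono)
      finally show ?thesis .
    qed
    then show ?thesis using LIMSEQ_le_const[OF lim, of m] by auto
  qed
  then have "m \<le> 0"
  proof (rule_tac field_le_epsilon)
    fix e :: real assume e: "0 < e" and le: "\<And>K. 0 < K \<Longrightarrow> m \<le> C / K"
    have "m \<le> C / ((\<bar>C\<bar> + 1) / e)" using e by (intro le) auto
    also have "\<dots> \<le> 0 + e" using e by (auto simp: field_simps abs_if)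
    finally show "m \<le> 0 + e" .
  qed
  have nonneg: "0 \<le> indicator E \<omega> * (c * Re (W t \<omega>) - b)" for \<omega>
    by (auto simp: E_def indicator_def)
  have int: "integrable M (\<lambda>\<omega>. indicator E \<omega> * (c * Re (W t \<omega>) - b))"
    using stopped_walk_moments[OF D t zero_less_one E c, of 0 b] by simp
  have "m = 0" using \<open>m \<le> 0\<close> nonneg by (intro antisym) (auto simp: m_def intro!: integral_nonneg_AE)
  then have "AE \<omega> in M. indicator E \<omega> * (c * Re (W t \<omega>) - b) = 0"
    unfolding m_def using integral_nonneg_eq_0_iff_AE[OF int] nonneg by auto
  then show ?thesis
    using AE_space
  proof eventually_elim
    case (elim \<omega>)
    then show ?case by (auto simp: E_def indicator_def not_le split: if_splits)
  qed
qed

end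

section \<open>Decay of survival inside a strip\<close>

context complex_brownian_motion
begin

text \<open>
  With $\varphi(x) = \cos(\theta(x-m))$ for the midpoint $m$ of the strip, the expectation $A_n$ of
  $\varphi(\mathrm{Re}\,W_{hn})$ over the surviving paths dominates a multiple of the survival probability.
  Outside the strip $\varphi$ remains nonnegative up to the distance \<open>a\<close>. So after an increment $y$ the
  restriction of $\varphi$ to the strip is at most $\varphi$ if $|y| < a$, and at most
  $\varphi + 2 \le \varphi + 2y^4/a^4$ otherwise; the fourth moment $3h^2$ of the increment gives the error term.
  An error of second order in \<open>h\<close> is what the limit $h \to 0$ needs.
\<close>

lemma strip_decay:
  fixes \<alpha> \<beta> \<theta> h :: real
  assumes D: "open D" and \<alpha>\<beta>: "\<alpha> < \<beta>" and \<theta>: "0 < \<theta>" "\<theta> * (\<beta> - \<alpha>) < pi" and h: "0 < h"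
    and strip: "\<And>t. 0 \<le> t \<Longrightarrow> AE \<omega> in M. \<omega> \<in> survive D t \<longrightarrow> \<alpha> \<le> Re (W t \<omega>) \<and> Re (W t \<omega>) \<le> \<beta>"
  defines "c0 \<equiv> cos (\<theta> * (\<beta> - \<alpha>) / 2)" and "a \<equiv> (pi / \<theta> - (\<beta> - \<alpha>)) / 2"
  shows "c0 * prob (survive D (h * real n)) \<le> (exp (- \<theta>\<^sup>2 * h / 2) + 6 * h\<^sup>2 / (a ^ 4 * c0)) ^ n"
proof -
  define m where "m = (\<alpha> + \<beta>) / 2"
  define \<phi> where "\<phi> x = cos (\<theta> * (x - m))" for x
  define \<rho> where "\<rho> = exp (- \<theta>\<^sup>2 * h / 2) + 6 * h\<^sup>2 / (a ^ 4 * c0)"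
  have \<phi>m[measurable]: "\<phi> \<in> borel_measurable borel"
    unfolding \<phi>_def by (intro borel_measurable_continuous_onI continuous_intros)
  have a: "0 < a" using \<theta> by (simp add: a_def field_simps)
  have half: "0 < \<theta> * (\<beta> - \<alpha>) / 2" "\<theta> * (\<beta> - \<alpha>) / 2 < pi / 2" using \<theta> \<alpha>\<beta> by auto
  have c0: "0 < c0" unfolding c0_def using half by (intro cos_gt_zero) auto
  have dist: "\<bar>\<theta> * (x - m)\<bar> \<le> \<theta> * (\<beta> - \<alpha>) / 2" if "\<alpha> \<le> x" "x \<le> \<beta>" for x
  proof -
    have "\<bar>x - m\<bar> \<le> (\<beta> - \<alpha>) / 2" using that by (auto simp: m_def abs_if field_simps)
    then have "\<theta> * \<bar>x - m\<bar> \<le> \<theta> * ((\<beta> - \<alpha>) / 2)" using \<theta> by (intro mult_left_mono) auto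
    then show ?thesis using \<theta> by (simp add: abs_mult)
  qed
  have \<phi>_ge: "c0 \<le> \<phi> x" if "\<alpha> \<le> x" "x \<le> \<beta>" for x
  proof -
    have "cos (\<theta> * (\<beta> - \<alpha>) / 2) \<le> cos \<bar>\<theta> * (x - m)\<bar>"
      using dist[OF that] half by (intro cos_monotone_0_pi_le) auto
    then show ?thesis by (simp add: c0_def \<phi>_def)
  qed
  have \<phi>_le: "\<phi> x \<le> 1" "- 1 \<le> \<phi> x" for x by (auto simp: \<phi>_def)
  have \<phi>_step: "indicator {\<alpha>..\<beta>} (x + y) * \<phi> (x + y) \<le> \<phi> (x + y) + 2 / a ^ 4 * y ^ 4"
    if x: "\<alpha> \<le> x" "x \<le> \<beta>" for x y
  proof (cases "x + y \<in> {\<alpha>..\<beta>}")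
    case True then show ?thesis using a by simp
  next
    case False
    have nn: "0 \<le> 2 / a ^ 4 * y ^ 4" using a by simp
    have "0 \<le> \<phi> (x + y) + 2 / a ^ 4 * y ^ 4"
    proof (cases "\<bar>y\<bar> < a")
      case True
      have "\<bar>\<theta> * (x + y - m)\<bar> \<le> \<bar>\<theta> * (x - m)\<bar> + \<bar>\<theta> * y\<bar>"
        using abs_triangle_ineq[of "\<theta> * (x - m)" "\<theta> * y"] by (simp add: algebra_simps)
      also have "\<dots> \<le> \<theta> * (\<beta> - \<alpha>) / 2 + \<theta> * a"
        using dist[OF x] \<theta> True by (intro add_mono) (auto simp: abs_mult)
      also have "\<dots> = pi / 2" using \<theta> by (simp add: a_def field_simps)
      finally have "0 \<le> cos \<bar>\<theta> * (x + y - m)\<bar>" by (intro cos_ge_zero) auto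
      then show ?thesis using nn by (simp add: \<phi>_def)
    next
      case False
      have "y ^ 4 = \<bar>y\<bar> ^ 4" by simp
      moreover have "a ^ 4 \<le> \<bar>y\<bar> ^ 4" using False a by (intro power_mono) auto
      ultimately have "a ^ 4 \<le> y ^ 4" by linarith
      then have "2 \<le> 2 / a ^ 4 * y ^ 4" using a by (simp add: field_simps)
      then show ?thesis using \<phi>_le(2)[of "x + y"] by linarith
    qed
    with False show ?thesis by simp
  qed
  define S where "S n = survive D (h * real n)" for n :: nat
  have Sp: "S n \<in> sets (past (h * real n))" and Se: "S n \<in> events" for n
    unfolding S_def using h by (auto intro!: survive_past survive_events D)
  have hn: "0 \<le> h * real n" for n using h by simp
  define A where "A n = expectation (\<lambda>\<omega>. indicator (S n) \<omega> * \<phi> (Re (W (h * real n) \<omega>)))" for n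
  have Wm[measurable]: "W (h * real n) \<in> borel_measurable M" for n using hn by (rule measurable_W)
  have int: "integrable M (\<lambda>\<omega>. indicator (S n) \<omega> * \<phi> (Re (W (h * real n) \<omega>)))" for n
  proof (rule integrable_indicator_times[OF Se])
    show "integrable M (\<lambda>\<omega>. \<phi> (Re (W (h * real n) \<omega>)))"
      by (rule integrable_const_bound[of _ 1]) (auto simp: \<phi>_def)
  qed
  have prob_le: "c0 * prob (S n) \<le> A n" for n
  proof -
    have "c0 * prob (S n) = expectation (\<lambda>\<omega>. indicator (S n) \<omega> * c0)" using Se by simp
    also have "\<dots> \<le> A n"
      unfolding A_def
    proof (rule integral_mono_AE[OF _ int])
      show "integrable M (\<lambda>\<omega>. indicator (S n) \<omega> * c0)" using integrable_indicator_event[OF Se] by simp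
      show "AE \<omega> in M. indicator (S n) \<omega> * c0 \<le> indicator (S n) \<omega> * \<phi> (Re (W (h * real n) \<omega>))"
        using strip[OF hn[of n]] by eventually_elim (auto simp: S_def indicator_def intro: \<phi>_ge)
    qed
    finally show ?thesis .
  qed
  have A_nonneg: "0 \<le> A n" for n
    using prob_le[of n] c0 by (intro order_trans[OF _ prob_le]) simp
  have step: "A (Suc n) \<le> \<rho> * A n" for n
  proof -
    let ?s = "h * real n" and ?t = "h * real (Suc n)"
    let ?\<zeta> = "\<lambda>\<omega>. Re (W ?t \<omega> - W ?s \<omega>)"
    have st: "0 \<le> ?s" "?s < ?t" "?t - ?s = h" using h by (auto simp: algebra_simps)
    note G = Re_increment_gauss[OF st(1,2), unfolded st(3)]
    note mom = gaussian_moments[OF G h]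
    have Xp: "(\<lambda>\<omega>. Re (W ?s \<omega>)) \<in> borel_measurable (past ?s)"
      using W_measurable_past[OF st(1) order_refl] by measurable
    have Ip: "(indicator (S n) :: 'a \<Rightarrow> real) \<in> borel_measurable (past ?s)"
      using Sp by (rule borel_measurable_indicator)
    have sin_m: "(\<lambda>x. sin (\<theta> * (x - m))) \<in> borel_measurable borel"
      by (intro borel_measurable_continuous_onI continuous_intros)
    define U where "U \<omega> = indicator (S n) \<omega> * \<phi> (Re (W ?s \<omega>))" for \<omega>
    define V where "V \<omega> = indicator (S n) \<omega> * sin (\<theta> * (Re (W ?s \<omega>) - m))" for \<omega>
    define I where "I \<omega> = (indicator (S n) \<omega> :: real)" for \<omega>
    have U: "U \<in> borel_measurable (past ?s)" "integrable M U"
      unfolding U_def using Ip measurable_compose[OF Xp \<phi>m] int[of n] by auto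
    have V: "V \<in> borel_measurable (past ?s)"
      unfolding V_def using Ip measurable_compose[OF Xp sin_m] by auto
    have Vi: "integrable M V"
      using measurable_past_imp_measurable[OF V]
      by (intro integrable_const_bound[of _ 1]) (auto simp: V_def abs_mult indicator_def)
    have I: "I \<in> borel_measurable (past ?s)" "integrable M I"
      unfolding I_def using Ip integrable_indicator_event[OF Se] by auto
    have cos_m: "(\<lambda>y. cos (\<theta> * y)) \<in> borel_measurable borel" and sin_m': "(\<lambda>y. sin (\<theta> * y)) \<in> borel_measurable borel"
      and pow_m: "(\<lambda>y::real. y ^ 4) \<in> borel_measurable borel"
      by (intro borel_measurable_continuous_onI continuous_intros)+
    have \<zeta>m: "?\<zeta> \<in> borel_measurable M" using Wm[of n] Wm[of "Suc n"] by measurable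
    have ci: "integrable M (\<lambda>\<omega>. cos (\<theta> * ?\<zeta> \<omega>))"
      by (rule integrable_const_bound[of _ 1]) (use measurable_compose[OF \<zeta>m cos_m] in auto)
    have si: "integrable M (\<lambda>\<omega>. sin (\<theta> * ?\<zeta> \<omega>))"
      by (rule integrable_const_bound[of _ 1]) (use measurable_compose[OF \<zeta>m sin_m'] in auto)
    have Ec: "expectation (\<lambda>\<omega>. cos (\<theta> * ?\<zeta> \<omega>)) = exp (- \<theta>\<^sup>2 * h / 2)"
      using gaussian_expectation_cos[OF G h, of \<theta> 0] by simp
    \<comment> \<open>A sine is a cosine shifted by a quarter period.\<close>
    have Es: "expectation (\<lambda>\<omega>. sin (\<theta> * ?\<zeta> \<omega>)) = 0"
    proof -
      have "cos (\<theta> * (- (pi / 2) / \<theta> + y)) = sin (\<theta> * y)" for y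
      proof -
        have "\<theta> * (- (pi / 2) / \<theta> + y) = - (pi / 2 - \<theta> * y)" using \<theta> by (simp add: field_simps)
        then show ?thesis by (simp only: cos_minus cos_sin_eq[symmetric]) (simp add: cos_diff)
      qed
      moreover have "cos (\<theta> * (- (pi / 2) / \<theta>)) = 0" using \<theta> by simp
      ultimately show ?thesis
        using gaussian_expectation_cos[OF G h, of \<theta> "- (pi / 2) / \<theta>"] by (simp only: mult_zero_right)
    qed
    note PU = past_times_increment[OF st(1,2) U cos_m ci]
    note PV = past_times_increment[OF st(1,2) V Vi sin_m' si]
    note PI = past_times_increment[OF st(1,2) I pow_m mom(5)]
    have "A (Suc n) \<le> expectation (\<lambda>\<omega>. U \<omega> * cos (\<theta> * ?\<zeta> \<omega>) - V \<omega> * sin (\<theta> * ?\<zeta> \<omega>) + 2 / a ^ 4 * (I \<omega> * (?\<zeta> \<omega>) ^ 4))"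
      unfolding A_def
    proof (rule integral_mono_AE[OF int])
      show "integrable M (\<lambda>\<omega>. U \<omega> * cos (\<theta> * ?\<zeta> \<omega>) - V \<omega> * sin (\<theta> * ?\<zeta> \<omega>) + 2 / a ^ 4 * (I \<omega> * (?\<zeta> \<omega>) ^ 4))"
        by (intro Bochner_Integration.integrable_add Bochner_Integration.integrable_diff integrable_mult_right PU(1) PV(1) PI(1))
      show "AE \<omega> in M. indicator (S (Suc n)) \<omega> * \<phi> (Re (W ?t \<omega>))
         \<le> U \<omega> * cos (\<theta> * ?\<zeta> \<omega>) - V \<omega> * sin (\<theta> * ?\<zeta> \<omega>) + 2 / a ^ 4 * (I \<omega> * (?\<zeta> \<omega>) ^ 4)"
        using strip[OF hn[of n]] strip[OF hn[of "Suc n"]]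
      proof eventually_elim
        case (elim \<omega>)
        have sub: "S (Suc n) \<subseteq> S n" unfolding S_def using h by (intro survive_anti) simp
        let ?x = "Re (W ?s \<omega>)" and ?y = "?\<zeta> \<omega>"
        have xy: "Re (W ?t \<omega>) = ?x + ?y" by simp
        show ?case
        proof (cases "\<omega> \<in> S n")
          case False
          then have "\<omega> \<notin> S (Suc n)" using sub by blast
          with False show ?thesis by (simp add: U_def V_def I_def)
        next
          case True
          then have x: "\<alpha> \<le> ?x" "?x \<le> \<beta>" using elim(1) by (auto simp: S_def)
          have add: "\<phi> (?x + ?y) = \<phi> ?x * cos (\<theta> * ?y) - sin (\<theta> * (?x - m)) * sin (\<theta> * ?y)"
          proof -
            have "\<theta> * (?x + ?y - m) = \<theta> * (?x - m) + \<theta> * ?y" by (simp add: algebra_simps)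
            then show ?thesis unfolding \<phi>_def by (simp only: cos_add)
          qed
          have "indicator (S (Suc n)) \<omega> * \<phi> (Re (W ?t \<omega>)) \<le> indicator {\<alpha>..\<beta>} (?x + ?y) * \<phi> (?x + ?y)"
          proof (cases "\<omega> \<in> S (Suc n)")
            case True
            then have "Re (W ?t \<omega>) \<in> {\<alpha>..\<beta>}" using elim(2) by (simp add: S_def)
            then have "?x + ?y \<in> {\<alpha>..\<beta>}" unfolding xy .
            with True show ?thesis unfolding xy by simp
          next
            case False
            have "0 \<le> indicator {\<alpha>..\<beta>} z * \<phi> z" for z
              using \<phi>_ge[of z] c0 by (cases "z \<in> {\<alpha>..\<beta>}") auto
            with False show ?thesis by simp
          qed
          also have "\<dots> \<le> \<phi> (?x + ?y) + 2 / a ^ 4 * ?y ^ 4" by (rule \<phi>_step[OF x])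
          finally have le: "indicator (S (Suc n)) \<omega> * \<phi> (Re (W ?t \<omega>)) \<le> \<phi> (?x + ?y) + 2 / a ^ 4 * ?y ^ 4" .
          have "U \<omega> = \<phi> ?x" "V \<omega> = sin (\<theta> * (?x - m))" "I \<omega> = 1"
            using True by (simp_all add: U_def V_def I_def)
          with le show ?thesis unfolding add by (simp only: mult_1_left)
        qed
      qed
    qed
    also have "\<dots> = expectation (\<lambda>\<omega>. U \<omega> * cos (\<theta> * ?\<zeta> \<omega>)) - expectation (\<lambda>\<omega>. V \<omega> * sin (\<theta> * ?\<zeta> \<omega>))
        + 2 / a ^ 4 * expectation (\<lambda>\<omega>. I \<omega> * (?\<zeta> \<omega>) ^ 4)"
      by (simp only: Bochner_Integration.integral_add[OF Bochner_Integration.integrable_diff[OF PU(1) PV(1)] integrable_mult_right[OF PI(1)]]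
          Bochner_Integration.integral_diff[OF PU(1) PV(1)] integral_mult_right_zero)
    also have "\<dots> = exp (- \<theta>\<^sup>2 * h / 2) * A n + 6 * h\<^sup>2 / a ^ 4 * prob (S n)"
    proof -
      have "expectation U = A n" unfolding U_def A_def ..
      moreover have "expectation I = prob (S n)" unfolding I_def using Se by simp
      ultimately show ?thesis unfolding PU(2) PV(2) PI(2) Ec Es mom(6) by simp
    qed
    also have "\<dots> \<le> exp (- \<theta>\<^sup>2 * h / 2) * A n + 6 * h\<^sup>2 / a ^ 4 * (A n / c0)"
    proof -
      have "prob (S n) \<le> A n / c0" using prob_le[of n] c0 by (simp add: field_simps)
      then show ?thesis using a by (intro add_left_mono mult_left_mono) auto
    qed
    also have "\<dots> = \<rho> * A n" by (simp add: \<rho>_def distrib_right)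
    finally show ?thesis .
  qed
  have \<rho>0: "0 \<le> \<rho>" using c0 a by (simp add: \<rho>_def)
  have "A n \<le> \<rho> ^ n" for n
  proof (induction n)
    case 0
    have "A 0 \<le> expectation (\<lambda>_. 1)"
      unfolding A_def using int[of 0] \<phi>_le by (intro integral_mono) (auto simp: indicator_def)
    then show ?case by (simp add: prob_space)
  next
    case (Suc n)
    have "A (Suc n) \<le> \<rho> * A n" by (rule step)
    also have "\<dots> \<le> \<rho> * \<rho> ^ n" using Suc \<rho>0 by (rule mult_left_mono)
    finally show ?case by simp
  qed
  from order_trans[OF prob_le this, of n] show ?thesis unfolding S_def \<rho>_def .
qed

end

text \<open>
  The limit exists, so it can be computed along multiples of \<open>h\<close>.
\<close>

lemma rate_le_of_geometric_decay:
  assumes lim: "((\<lambda>t. 1 / t * ln (p t)) \<longlongrightarrow> - L) at_top" and pos: "\<And>t. 0 \<le> t \<Longrightarrow> 0 < p t"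
    and h: "0 < h" and c0: "0 < c0" and \<rho>: "0 < \<rho>"
    and decay: "\<And>n::nat. c0 * p (h * real n) \<le> \<rho> ^ n"
  shows "- L \<le> ln \<rho> / h"
proof (rule LIMSEQ_le)
  have "filterlim (\<lambda>n. h * real n) at_top sequentially"
    using h by real_asymp
  from filterlim_compose[OF lim this]
  show "(\<lambda>n. 1 / (h * real n) * ln (p (h * real n))) \<longlonglongrightarrow> - L" .
  show "(\<lambda>n. (real n * ln \<rho> - ln c0) / (h * real n)) \<longlonglongrightarrow> ln \<rho> / h"
    using h by real_asymp (simp add: field_simps)
  show "\<exists>N. \<forall>n\<ge>N. 1 / (h * real n) * ln (p (h * real n)) \<le> (real n * ln \<rho> - ln c0) / (h * real n)"
  proof (rule exI[of _ 1], intro allI impI)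
    fix n :: nat assume n: "1 \<le> n"
    have p: "0 < p (h * real n)" using h by (intro pos) simp
    have "ln (c0 * p (h * real n)) \<le> ln (\<rho> ^ n)"
      using decay[of n] c0 p by (intro ln_mono) auto
    then have "ln (p (h * real n)) \<le> real n * ln \<rho> - ln c0"
      using c0 p \<rho> by (simp add: ln_mult_pos ln_realpow)
    then have "ln (p (h * real n)) / (h * real n) \<le> (real n * ln \<rho> - ln c0) / (h * real n)"
      using h n by (intro divide_right_mono) auto
    then show "1 / (h * real n) * ln (p (h * real n)) \<le> (real n * ln \<rho> - ln c0) / (h * real n)" by simp
  qed
qed

context complex_brownian_motion
begin

lemma strip_rate:
  assumes D: "open D" and \<alpha>\<beta>: "\<alpha> < \<beta>"
    and strip: "\<And>t. 0 \<le> t \<Longrightarrow> AE \<omega> in M. \<omega> \<in> survive D t \<longrightarrow> \<alpha> \<le> Re (W t \<omega>) \<and> Re (W t \<omega>) \<le> \<beta>"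
    and lim: "((\<lambda>t. 1 / t * ln (prob (survive D t))) \<longlongrightarrow> - L) at_top"
    and pos: "\<And>t. 0 \<le> t \<Longrightarrow> 0 < prob (survive D t)"
  shows "pi\<^sup>2 / (2 * (\<beta> - \<alpha>)\<^sup>2) \<le> L"
proof -
  have theta: "\<theta>\<^sup>2 / 2 \<le> L" if \<theta>: "0 < \<theta>" "\<theta> * (\<beta> - \<alpha>) < pi" for \<theta>
  proof -
    define c0 where "c0 = cos (\<theta> * (\<beta> - \<alpha>) / 2)"
    define K where "K = 6 / (((pi / \<theta> - (\<beta> - \<alpha>)) / 2) ^ 4 * c0)"
    have "0 < \<theta> * (\<beta> - \<alpha>) / 2" "\<theta> * (\<beta> - \<alpha>) / 2 < pi / 2" using \<theta> \<alpha>\<beta> by auto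
    then have c0: "0 < c0" unfolding c0_def by (intro cos_gt_zero) auto
    then have K: "0 \<le> K" by (simp add: K_def)
    have "- L \<le> ln (exp (- \<theta>\<^sup>2 * h / 2) + K * h\<^sup>2) / h" if h: "0 < h" for h
    proof (rule rate_le_of_geometric_decay[OF lim pos h c0])
      show "0 < exp (- \<theta>\<^sup>2 * h / 2) + K * h\<^sup>2" using K by (intro add_pos_nonneg) auto
      show "c0 * prob (survive D (h * real n)) \<le> (exp (- \<theta>\<^sup>2 * h / 2) + K * h\<^sup>2) ^ n" for n
        using strip_decay[OF D \<alpha>\<beta> \<theta> h strip, of n] by (simp add: c0_def K_def)
    qed
    then have "eventually (\<lambda>h. - L \<le> ln (exp (- \<theta>\<^sup>2 * h / 2) + K * h\<^sup>2) / h) (at_right 0)"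
      by (auto simp: eventually_at_filter)
    moreover have "((\<lambda>h. ln (exp (- \<theta>\<^sup>2 * h / 2) + K * h\<^sup>2) / h) \<longlongrightarrow> - \<theta>\<^sup>2 / 2) (at_right 0)"
      using \<theta>(1) by real_asymp
    ultimately have "- L \<le> - \<theta>\<^sup>2 / 2"
      by (intro tendsto_lowerbound) auto
    then show ?thesis by simp
  qed
  show ?thesis
  proof (rule field_le_mult_one_interval)
    fix z :: real assume z: "0 < z" "z < 1"
    define \<theta> where "\<theta> = sqrt z * pi / (\<beta> - \<alpha>)"
    have "0 < \<theta>" using z \<alpha>\<beta> by (simp add: \<theta>_def)
    moreover have "\<theta> * (\<beta> - \<alpha>) < pi" using z \<alpha>\<beta> by (simp add: \<theta>_def)
    ultimately have "\<theta>\<^sup>2 / 2 \<le> L" by (rule theta)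
    moreover have "\<theta>\<^sup>2 / 2 = z * (pi\<^sup>2 / (2 * (\<beta> - \<alpha>)\<^sup>2))"
      using z by (simp add: \<theta>_def power_divide power_mult_distrib)
    ultimately show "z * (pi\<^sup>2 / (2 * (\<beta> - \<alpha>)\<^sup>2)) \<le> L" by simp
  qed
qed

end

section \<open>Exit law and support\<close>

context complex_brownian_motion
begin

text \<open>
  The exit position is the limit of the positions at the exit time rounded up to dyadic numbers. Without
  measurability the push-forward of the measure would carry no information about the exit position.
\<close>

lemma W_exit_measurable:
  assumes D: "open D"
  shows "(\<lambda>\<omega>. W (enn2real (exit_time W D \<omega>)) \<omega>) \<in> borel_measurable M"
proof (rule borel_measurable_LIMSEQ_metric)
  define k where "k n \<omega> = nat \<lceil>2 ^ n * enn2real (exit_time W D \<omega>)\<rceil>" for n :: nat and \<omega>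
  have \<tau>m[measurable]: "exit_time W D \<in> borel_measurable M" by (rule exit_time_measurable[OF D])
  show "(\<lambda>\<omega>. W (real (k n \<omega>) / 2 ^ n) \<omega>) \<in> borel_measurable M" for n
  proof (rule measurable_compose_countable[where f="\<lambda>i. W (real i / 2 ^ n)" and g="k n"])
    show "W (real i / 2 ^ n) \<in> borel_measurable M" for i :: nat by (rule measurable_W) simp
    show "k n \<in> M \<rightarrow>\<^sub>M count_space UNIV" unfolding k_def by measurable
  qed
  fix \<omega> assume \<omega>: "\<omega> \<in> space M"
  let ?T = "enn2real (exit_time W D \<omega>)"
  have b: "?T \<le> real (k n \<omega>) / 2 ^ n" "real (k n \<omega>) / 2 ^ n \<le> ?T + 1 / 2 ^ n" for n
  proof -
    have nn: "0 \<le> 2 ^ n * ?T" by simp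
    have "2 ^ n * ?T \<le> real (k n \<omega>)" "real (k n \<omega>) \<le> 2 ^ n * ?T + 1"
      unfolding k_def using nn by linarith+
    then show "?T \<le> real (k n \<omega>) / 2 ^ n" "real (k n \<omega>) / 2 ^ n \<le> ?T + 1 / 2 ^ n"
      by (simp_all add: field_simps)
  qed
  have "(\<lambda>n. (1 / 2) ^ n :: real) \<longlonglongrightarrow> 0" by (rule LIMSEQ_power_zero) simp
  from tendsto_add[OF tendsto_const[of ?T] this]
  have h0: "(\<lambda>n. ?T + 1 / 2 ^ n) \<longlonglongrightarrow> ?T" by (simp add: power_divide)
  have lim: "(\<lambda>n. real (k n \<omega>) / 2 ^ n) \<longlonglongrightarrow> ?T"
    by (rule tendsto_sandwich[OF _ _ tendsto_const[of ?T] h0]) (use b in auto)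
  show "(\<lambda>n. W (real (k n \<omega>) / 2 ^ n) \<omega>) \<longlonglongrightarrow> W ?T \<omega>"
    by (rule continuous_on_tendsto_compose[OF continuous_paths[OF \<omega>] lim]) auto
qed

end

text \<open>
  By the Lindeloef property, countably many null open sets already cover the complement of the support.
\<close>

lemma AE_measure_support:
  assumes "sets \<mu> = sets borel"
  shows "AE x in \<mu>. x \<in> measure_support \<mu>"
proof -
  let ?F = "{U. open U \<and> emeasure \<mu> U = 0}"
  obtain F where F: "F \<subseteq> ?F" "countable F" "\<Union>F = \<Union>?F"
    using Lindelof[of ?F] by auto
  have "\<Union>F \<in> null_sets \<mu>"
    using F(1,2) assms by (intro null_sets_UN'[of F "\<lambda>x. x", simplified]) (auto simp: null_sets_def)
  moreover have "{x \<in> space \<mu>. x \<notin> measure_support \<mu>} \<subseteq> \<Union>F"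
    unfolding F(3) measure_support_def by (auto simp: not_gr_zero)
  ultimately show ?thesis by (rule AE_I')
qed

text \<open>
  A nonempty set of reals excludes $\alpha = \infty$ and $\beta = -\infty$, so a difference other than
  $\infty$ forces both ends to be finite.
\<close>

lemma smallest_interval_finite:
  assumes S: "smallest_interval S \<alpha> \<beta>" "S \<noteq> {}" and fin: "\<beta> - \<alpha> \<noteq> \<infinity>"
  obtains a b where "\<alpha> = ereal a" "\<beta> = ereal b" "S \<subseteq> {a..b}" "a \<le> b"
proof -
  obtain x where x: "x \<in> S" using S(2) by blast
  then have "\<alpha> \<le> ereal x" "ereal x \<le> \<beta>" using S(1) by (auto simp: smallest_interval_def)
  with fin obtain a b where ab: "\<alpha> = ereal a" "\<beta> = ereal b"
    by (cases \<alpha>; cases \<beta>) auto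
  have "S \<subseteq> {a..b}" using S(1) unfolding smallest_interval_def ab by auto
  moreover have "a \<le> b" using calculation x by auto
  ultimately show thesis using ab that by blast
qed

theorem theorem2:
  fixes M :: "'a measure" and W :: "real \<Rightarrow> 'a \<Rightarrow> complex"
    and D :: "complex set" and \<mu> :: "real measure" and \<alpha> \<beta> :: ereal
  assumes "complex_brownian_motion M W"
    and "real_distribution \<mu>"
    and "integrable \<mu> (\<lambda>x. x)" and "prob_space.expectation \<mu> (\<lambda>x. x) = 0"
    and "integrable \<mu> (\<lambda>x. x\<^sup>2)" and "prob_space.variance \<mu> (\<lambda>x. x) \<noteq> 0"
    and "solves_CSEP M W D \<mu>"
    and "smallest_interval (measure_support \<mu>) \<alpha> \<beta>"
  shows "rate M W D \<ge>
    (if \<beta> - \<alpha> = \<infinity> then 0 else pi\<^sup>2 / (2 * (real_of_ereal (\<beta> - \<alpha>))\<^sup>2))"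
proof -
  interpret complex_brownian_motion M W by fact
  interpret \<mu>: real_distribution \<mu> by fact
  have D: "open D" "0 \<in> D"
    and distr: "distr M borel (\<lambda>\<omega>. Re (W (enn2real (exit_time W D \<omega>)) \<omega>)) = \<mu>"
    and fin: "(\<integral>\<^sup>+\<omega>. exit_time W D \<omega> \<partial>M) < \<infinity>"
    using assms(7) by (auto simp: solves_CSEP_def)
  obtain L where L: "0 \<le> L" "((\<lambda>t. 1 / t * ln (prob (survive D t))) \<longlongrightarrow> - L) at_top"
      "\<And>t. 0 \<le> t \<Longrightarrow> 0 < prob (survive D t)"
    using survival_rate_exists[OF D] by blast
  have rate: "rate M W D = L" by (rule rate_eqI[OF D(1) L(2)])
  show ?thesis
  proof (cases "\<beta> - \<alpha> = \<infinity>")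
    case True then show ?thesis using L(1) rate by simp
  next
    case False
    have supp: "AE x in \<mu>. x \<in> measure_support \<mu>" by (rule AE_measure_support) simp
    have "measure_support \<mu> \<noteq> {}"
    proof
      assume "measure_support \<mu> = {}"
      then have "AE x in \<mu>. False" using supp by simp
      then show False by (simp add: \<mu>.AE_False)
    qed
    then obtain a b where ab: "\<alpha> = ereal a" "\<beta> = ereal b" "measure_support \<mu> \<subseteq> {a..b}" "a \<le> b"
      using smallest_interval_finite[OF assms(8) _ False] by blast
    have Xm: "(\<lambda>\<omega>. Re (W (enn2real (exit_time W D \<omega>)) \<omega>)) \<in> borel_measurable M"
      using W_exit_measurable[OF D(1)] by measurable
    have "AE x in distr M borel (\<lambda>\<omega>. Re (W (enn2real (exit_time W D \<omega>)) \<omega>)). a \<le> x \<and> x \<le> b"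
      unfolding distr using supp by eventually_elim (use ab(3) in auto)
    then have exit: "AE \<omega> in M. a \<le> Re (W (enn2real (exit_time W D \<omega>)) \<omega>) \<and> Re (W (enn2real (exit_time W D \<omega>)) \<omega>) \<le> b"
      by (subst (asm) AE_distr_iff[OF Xm]) auto
    have strip: "AE \<omega> in M. \<omega> \<in> survive D t \<longrightarrow> a \<le> Re (W t \<omega>) \<and> Re (W t \<omega>) \<le> b" if t: "0 \<le> t" for t
    proof -
      have "AE \<omega> in M. \<omega> \<in> survive D t \<longrightarrow> 1 * Re (W t \<omega>) \<le> b"
        using exit by (intro exit_bound_propagates[OF D(1) fin _ t]) auto
      moreover have "AE \<omega> in M. \<omega> \<in> survive D t \<longrightarrow> - 1 * Re (W t \<omega>) \<le> - a"
        using exit by (intro exit_bound_propagates[OF D(1) fin _ t]) auto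
      ultimately show ?thesis by eventually_elim auto
    qed
    show ?thesis
    proof (cases "a = b")
      \<comment> \<open>For a one-point interval the bound reads pi^2 / 0, which is 0.\<close>
      case True then show ?thesis using L(1) rate by (simp add: ab)
    next
      case False
      then have "a < b" using ab(4) by simp
      then have "pi\<^sup>2 / (2 * (b - a)\<^sup>2) \<le> L" using strip L(2,3) by (rule strip_rate[OF D(1)])
      then show ?thesis by (simp add: rate ab)
    qed
  qed
qed

end
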